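(* For every positive integer $d$ there is an integer $N(d)$ such that for all integers $n\geq N(d)$ the polynomial $$J_{\mathrm{PL}}^{d,n}(X)=\sum_{j=0}^d\binom{d}{j}\mathrm{PL}(n+j)X^j$$ is hyperbolic, i.e. all of its roots are real.
   Context: A plane partition of size $n$ is an array $\pi=(\pi_{i,j})$ of non-negative integers with weakly decreasing rows and columns and $\sum_{i,j}\pi_{i,j}=n$. $\mathrm{PL}(n)$ denotes the number of plane partitions of size $n$; equivalently (MacMahon), $\sum_{n\ge 0}\mathrm{PL}(n)x^n=\prod_{n\ge 1}(1-x^n)^{-n}$. The polynomial $J_{\mathrm{PL}}^{d,n}(X)$ is called the Jensen polynomial of degree $d$ and shift $n$ of the sequence $\mathrm{PL}$. A polynomial with real coefficients is hyperbolic if all of its complex roots are real. *)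

theory Defs
  imports Complex_Main "HOL-Computational_Algebra.Polynomial"
begin

text \<open>
  Rows and columns are indexed from 0, and an array is padded with zeros to a function on all of
  \<open>nat \<times> nat\<close>. Entries are non-negative integers, so a finite total size forces finite support;
  finiteness is stated because \<open>sum\<close> over an infinite set is 0.
\<close>

definition plane_partition_of :: "(nat \<Rightarrow> nat \<Rightarrow> nat) \<Rightarrow> nat \<Rightarrow> bool" where
  "plane_partition_of \<pi> n \<longleftrightarrow>
     (\<forall>i. antimono (\<lambda>j. \<pi> i j)) \<and>
     (\<forall>j. antimono (\<lambda>i. \<pi> i j)) \<and>
     finite {(i, j). \<pi> i j \<noteq> 0} \<and>
     (\<Sum>(i, j) \<in> {(i, j). \<pi> i j \<noteq> 0}. \<pi> i j) = n"

definition PL :: "nat \<Rightarrow> nat" where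
  "PL n = card {\<pi>. plane_partition_of \<pi> n}"

definition jensen_poly :: "(nat \<Rightarrow> real) \<Rightarrow> nat \<Rightarrow> nat \<Rightarrow> real poly" where
  "jensen_poly a d n = (\<Sum>j = 0..d. monom (real (d choose j) * a (n + j)) j)"

definition hyperbolic :: "real poly \<Rightarrow> bool" where
  "hyperbolic p \<longleftrightarrow> (\<forall>z::complex. poly (map_poly complex_of_real p) z = 0 \<longrightarrow> z \<in> \<real>)"

text \<open>The cardinality in \<open>PL\<close> is that of a finite set.\<close>

lemma plane_partition_of_bounds:
  assumes "plane_partition_of \<pi> n" "\<pi> i j \<noteq> 0"
  shows "i < n" "j < n" "\<pi> i j \<le> n"
proof -
  let ?S = "{(i, j). \<pi> i j \<noteq> 0}"
  have fin: "finite ?S" and sum: "(\<Sum>(i, j) \<in> ?S. \<pi> i j) = n"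
    and row: "\<And>i. antimono (\<lambda>j. \<pi> i j)" and col: "\<And>j. antimono (\<lambda>i. \<pi> i j)"
    using assms(1) by (simp_all add: plane_partition_of_def)
  have card: "card ?S \<le> n"
  proof -
    have "card ?S = (\<Sum>x \<in> ?S. 1)" by simp
    also have "\<dots> \<le> (\<Sum>(i, j) \<in> ?S. \<pi> i j)" by (rule sum_mono) auto
    finally show ?thesis using sum by simp
  qed
  have "(\<lambda>k. (k, j)) ` {..i} \<subseteq> ?S"
    using antimonoD[OF col[of j]] assms(2) by fastforce
  from card_mono[OF fin this] have "Suc i \<le> card ?S"
    by (subst (asm) card_image) (auto simp: inj_on_def)
  then show "i < n" using card by simp
  have "(\<lambda>k. (i, k)) ` {..j} \<subseteq> ?S"
    using antimonoD[OF row[of i]] assms(2) by fastforce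
  from card_mono[OF fin this] have "Suc j \<le> card ?S"
    by (subst (asm) card_image) (auto simp: inj_on_def)
  then show "j < n" using card by simp
  have "(case (i, j) of (i, j) \<Rightarrow> \<pi> i j) \<le> (\<Sum>(i, j) \<in> ?S. \<pi> i j)"
    using assms(2) fin by (intro member_le_sum) auto
  then show "\<pi> i j \<le> n" using sum by simp
qed

lemma finite_plane_partitions_of: "finite {\<pi>. plane_partition_of \<pi> n}"
proof -
  let ?A = "{..<n} \<times> {..<n}"
  let ?F = "{f. \<forall>x. (x \<in> ?A \<longrightarrow> f x \<in> {..n}) \<and> (x \<notin> ?A \<longrightarrow> f x = (0::nat))}"
  have "finite ?F" by (rule finite_set_of_finite_funs) auto
  moreover have "{\<pi>. plane_partition_of \<pi> n} \<subseteq> curry ` ?F"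
  proof
    fix \<pi> assume "\<pi> \<in> {\<pi>. plane_partition_of \<pi> n}"
    then have *: "plane_partition_of \<pi> n" by simp
    have "case_prod \<pi> \<in> ?F"
    proof (rule CollectI, intro allI conjI impI)
      fix x assume "x \<in> ?A"
      obtain i j where x: "x = (i, j)" by (cases x)
      have "\<pi> i j \<le> n"
        using plane_partition_of_bounds(3)[OF *, of i j] by (cases "\<pi> i j = 0") simp_all
      then show "case_prod \<pi> x \<in> {..n}" by (simp add: x)
    next
      fix x assume "x \<notin> ?A"
      then show "case_prod \<pi> x = 0"
        using plane_partition_of_bounds(1,2)[OF *] by (cases x) auto
    qed
    then show "\<pi> \<in> curry ` ?F" by (rule rev_image_eqI) simp
  qed
  ultimately show ?thesis by (meson finite_imageI finite_subset)
qed

end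

theory Submission
  imports Defs "HOL-Probability.Probability" "HOL-Complex_Analysis.Complex_Analysis"
    "HOL-Real_Asymp.Real_Asymp"
begin

text \<open>
  The proof reads the Jensen polynomial as an integral against the characteristic function of a
  random plane partition and shows that, after rescaling, it converges to a Hermite polynomial.

  By MacMahon's formula, \<open>\<Sum>n. PL n * x ^ n = (\<Prod>n\<ge>1. (1 - x ^ n) ^ (- n))\<close>, which is
  \<open>exp (\<Sum>N. w N * x ^ N)\<close> with \<open>w N = \<sigma>\<^sub>2(N) / N\<close>. Hence, for \<open>0 < q < 1\<close>, the probability weights
  \<open>PL n * q ^ n / exp (\<Sum>N. w N * q ^ N)\<close> are the distribution of a compound Poisson variable: a sum
  of independent multiples \<open>N * X N\<close>, where \<open>X N\<close> is Poisson with parameter \<open>w N * q ^ N\<close>. Its mean and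
  variance are the power series \<open>moment 1 q\<close> and \<open>moment 2 q\<close> and its characteristic function is
  \<open>exp (log_char q t)\<close>. Choose \<open>q\<close> such that the mean is \<open>n\<close>, and let \<open>\<sigma>\<close> be the standard
  deviation. Fourier inversion and the binomial theorem give, for \<open>X = q * (- 1 + y / \<sigma>)\<close>, a positive
  multiple of \<open>\<sigma> ^ (d + 1) * J(X)\<close> as the integral over \<open>\<bar>u\<bar> \<le> \<pi> * \<sigma>\<close> of
  \<open>(\<sigma> * (1 - cis (- u / \<sigma>)) + y * cis (- u / \<sigma>)) ^ d * exp (log_char q (u / \<sigma>)) * cis (- n * u / \<sigma>)\<close>
  (lemma \<open>jensen_as_scaled_integral\<close>).

  As \<open>n\<close> grows, \<open>q\<close> tends to \<open>1\<close>. The first factor tends to \<open>(y + \<i> * u) ^ d\<close>, and the rest tends to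
  \<open>exp (- u\<^sup>2 / 2)\<close>, which is the local central limit theorem for this family. Its two ingredients are
  a third order Taylor estimate (\<open>log_char_taylor\<close>) and a bound by a fixed multiple of
  \<open>exp (- \<bar>u\<bar> / 32)\<close>, uniform in \<open>q\<close> (\<open>norm_exp_log_char_le\<close>). Both rest on the bounds
  \<open>N \<le> w N \<le> 2 * N\<close>. By dominated convergence the integral tends to
  \<open>\<integral> (y + \<i> * u) ^ d * exp (- u\<^sup>2 / 2) du\<close>, which is \<open>sqrt (2 * \<pi>)\<close> times the value at \<open>y\<close> of the
  \<open>d\<close>-th Hermite polynomial. That polynomial takes values of alternating sign at \<open>d + 1\<close> suitable points;
  for large \<open>n\<close> the Jensen polynomial inherits these signs, so it has \<open>d\<close> distinct real roots, as many as its
  degree permits.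

  MacMahon's formula is derived from the Cauchy identity for Schur functions, which in turn rests
  on a bijection that reflects intervals. A plane partition is the sequence of its diagonals;
  consecutive diagonals interlace, and the weight of a chain of interlacing sequences is a Schur function.
\<close>

section \<open>Interlacing sequences and the Cauchy identity\<close>

definition interlace :: "(nat \<Rightarrow> nat) \<Rightarrow> (nat \<Rightarrow> nat) \<Rightarrow> bool" (infix "\<prec>\<prec>" 50) where
  "\<mu> \<prec>\<prec> \<rho> \<longleftrightarrow> (\<forall>i. \<mu> i \<le> \<rho> i \<and> \<rho> (Suc i) \<le> \<mu> i)"

definition supp :: "(nat \<Rightarrow> nat) \<Rightarrow> nat set" where
  "supp \<rho> = {i. \<rho> i \<noteq> 0}"

text \<open>
  The value for a sequence of infinite support is \<open>0\<close>; such sequences carry no weight below, because a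
  chain of interlacing sequences that starts at the zero sequence has finite supports.
\<close>

definition psize :: "(nat \<Rightarrow> nat) \<Rightarrow> nat" where
  "psize \<rho> = sum \<rho> (supp \<rho>)"

definition zero_seq :: "nat \<Rightarrow> nat" where
  "zero_seq = (\<lambda>_. 0)"

text \<open>
  The one-variable skew Schur function: the weight of adding the horizontal strip \<open>\<rho> / \<mu>\<close>.
  Values in \<open>ennreal\<close> allow sums over all sequences to be rearranged freely, without convergence
  conditions; the sums are integrals over the counting measure.
\<close>

definition skew_weight :: "ennreal \<Rightarrow> (nat \<Rightarrow> nat) \<Rightarrow> (nat \<Rightarrow> nat) \<Rightarrow> ennreal" where
  "skew_weight x \<mu> \<rho> = (if \<mu> \<prec>\<prec> \<rho> then x ^ (psize \<rho> - psize \<mu>) else 0)"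

definition geometric_sum :: "ennreal \<Rightarrow> ennreal" where
  "geometric_sum z = (\<integral>\<^sup>+ m. z ^ m \<partial>count_space (UNIV :: nat set))"

lemma psize_eq:
  assumes "supp \<rho> \<subseteq> {..<K}"
  shows "psize \<rho> = (\<Sum>i<K. \<rho> i)"
  unfolding psize_def
  by (rule sum.mono_neutral_left) (use assms in \<open>auto simp: supp_def\<close>)

lemma finite_supp_iff: "finite (supp \<rho>) \<longleftrightarrow> (\<exists>K. supp \<rho> \<subseteq> {..<K})"
  using finite_nat_iff_bounded by blast

lemma zero_seq_simps [simp]: "supp zero_seq = {}" "psize zero_seq = 0"
  "zero_seq \<prec>\<prec> zero_seq"
  by (simp_all add: psize_def supp_def zero_seq_def interlace_def)

lemma interlace_zero: "\<mu> \<prec>\<prec> zero_seq \<Longrightarrow> \<mu> = zero_seq"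
  by (auto simp: interlace_def zero_seq_def fun_eq_iff)

lemma supp_interlace1: "\<mu> \<prec>\<prec> \<rho> \<Longrightarrow> supp \<rho> \<subseteq> {..<K} \<Longrightarrow> supp \<mu> \<subseteq> {..<K}"
  unfolding supp_def interlace_def by (auto simp: subset_iff) (metis le_zero_eq not_gr_zero)

lemma supp_interlace2:
  assumes "\<mu> \<prec>\<prec> \<rho>" "supp \<mu> \<subseteq> {..<K}"
  shows "supp \<rho> \<subseteq> {..<Suc K}"
proof
  fix i assume i: "i \<in> supp \<rho>"
  show "i \<in> {..<Suc K}"
  proof (cases i)
    case (Suc j)
    have "\<rho> (Suc j) \<le> \<mu> j" using assms(1) by (simp add: interlace_def)
    then have "j \<in> supp \<mu>" using i Suc by (auto simp: supp_def)
    then show ?thesis using assms(2) Suc by auto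
  qed simp
qed

lemma finite_supp_interlace: "\<mu> \<prec>\<prec> \<rho> \<Longrightarrow> finite (supp \<mu>) \<longleftrightarrow> finite (supp \<rho>)"
  unfolding finite_supp_iff using supp_interlace1 supp_interlace2 by blast

lemma psize_mono:
  assumes "\<mu> \<prec>\<prec> \<rho>" "finite (supp \<rho>)"
  shows "psize \<mu> \<le> psize \<rho>"
proof -
  obtain K where K: "supp \<rho> \<subseteq> {..<K}" using assms(2) finite_supp_iff by blast
  show ?thesis
    using assms(1) by (simp add: psize_eq[OF K] psize_eq[OF supp_interlace1[OF assms(1) K]] interlace_def sum_mono)
qed

text \<open>
  This is the local form of the Robinson-Schensted-Knuth correspondence. Given \<open>\<rho>\<close> and \<open>\<mu>\<close>, the entry
  \<open>\<nu> (Suc i)\<close> of a common upper neighbour and the entry \<open>\<kappa> i\<close> of a common lower neighbour both range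
  over the interval from \<open>max (\<rho> (Suc i)) (\<mu> (Suc i))\<close> to \<open>min (\<rho> i) (\<mu> i)\<close>, independently for
  different \<open>i\<close>. Reflecting each interval turns \<open>\<kappa>\<close> into \<open>\<nu>\<close>. The first entry of \<open>\<nu>\<close> is only bounded
  from below, and its excess over that bound is the free parameter \<open>m\<close>.
\<close>

definition toggle_up :: "(nat \<Rightarrow> nat) \<Rightarrow> (nat \<Rightarrow> nat) \<Rightarrow> nat \<times> (nat \<Rightarrow> nat) \<Rightarrow> nat \<Rightarrow> nat" where
  "toggle_up \<rho> \<mu> = (\<lambda>(m, \<kappa>) i. case i of 0 \<Rightarrow> max (\<rho> 0) (\<mu> 0) + m
     | Suc j \<Rightarrow> max (\<rho> (Suc j)) (\<mu> (Suc j)) + min (\<rho> j) (\<mu> j) - \<kappa> j)"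

lemma bij_betw_toggle_up:
  "bij_betw (toggle_up \<rho> \<mu>) (UNIV \<times> {\<kappa>. \<kappa> \<prec>\<prec> \<rho> \<and> \<kappa> \<prec>\<prec> \<mu>}) {\<nu>. \<rho> \<prec>\<prec> \<nu> \<and> \<mu> \<prec>\<prec> \<nu>}"
proof (rule bij_betw_byWitness[where f' = "\<lambda>\<nu>. (\<nu> 0 - max (\<rho> 0) (\<mu> 0),
      \<lambda>j. max (\<rho> (Suc j)) (\<mu> (Suc j)) + min (\<rho> j) (\<mu> j) - \<nu> (Suc j))"], goal_cases)
  case 1
  have "max (\<rho> (Suc j)) (\<mu> (Suc j)) + min (\<rho> j) (\<mu> j)
      - (max (\<rho> (Suc j)) (\<mu> (Suc j)) + min (\<rho> j) (\<mu> j) - \<kappa> j) = \<kappa> j"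
    if "\<kappa> \<prec>\<prec> \<rho>" "\<kappa> \<prec>\<prec> \<mu>" for \<kappa> j
  proof -
    have "\<kappa> j \<le> min (\<rho> j) (\<mu> j)" using that by (simp add: interlace_def)
    then show ?thesis by linarith
  qed
  then show ?case by (auto simp: toggle_up_def)
next
  case 2
  show ?case
  proof (intro ballI ext, goal_cases)
    case (1 \<nu> i)
    then have *: "\<And>j. \<rho> j \<le> \<nu> j" "\<And>j. \<mu> j \<le> \<nu> j" "\<And>j. \<nu> (Suc j) \<le> \<rho> j" "\<And>j. \<nu> (Suc j) \<le> \<mu> j"
      by (auto simp: interlace_def)
    show ?case
    proof (cases i)
      case 0
      then show ?thesis using *(1,2)[of 0] by (simp add: toggle_up_def)
    next
      case (Suc j)
      have "min (\<rho> j) (\<mu> j) \<ge> \<nu> (Suc j)" using *(3,4)[of j] by simp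
      then show ?thesis using Suc by (simp add: toggle_up_def del: min.bounded_iff)
    qed
  qed
next
  case 3
  show ?case
  proof (safe, goal_cases)
    case (1 _ m \<kappa>)
    show ?case unfolding interlace_def
    proof (intro allI conjI)
      fix i
      show "\<rho> i \<le> toggle_up \<rho> \<mu> (m, \<kappa>) i"
      proof (cases i)
        case (Suc j)
        have "\<kappa> j \<le> min (\<rho> j) (\<mu> j)" using 1 by (auto simp: interlace_def)
        then show ?thesis using Suc by (simp add: toggle_up_def del: min.bounded_iff)
      qed (simp add: toggle_up_def)
      have "\<rho> (Suc i) \<le> \<kappa> i" "\<mu> (Suc i) \<le> \<kappa> i" using 1 by (auto simp: interlace_def)
      then show "toggle_up \<rho> \<mu> (m, \<kappa>) (Suc i) \<le> \<rho> i" by (simp add: toggle_up_def)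
    qed
  next
    case (2 _ m \<kappa>)
    show ?case unfolding interlace_def
    proof (intro allI conjI)
      fix i
      show "\<mu> i \<le> toggle_up \<rho> \<mu> (m, \<kappa>) i"
      proof (cases i)
        case (Suc j)
        have "\<kappa> j \<le> min (\<rho> j) (\<mu> j)" using 2 by (auto simp: interlace_def)
        then show ?thesis using Suc by (simp add: toggle_up_def del: min.bounded_iff)
      qed (simp add: toggle_up_def)
      have "\<rho> (Suc i) \<le> \<kappa> i" "\<mu> (Suc i) \<le> \<kappa> i" using 2 by (auto simp: interlace_def)
      then show "toggle_up \<rho> \<mu> (m, \<kappa>) (Suc i) \<le> \<mu> i" by (simp add: toggle_up_def)
    qed
  qed
next
  case 4
  have "(\<lambda>j. max (\<rho> (Suc j)) (\<mu> (Suc j)) + min (\<rho> j) (\<mu> j) - \<nu> (Suc j)) \<prec>\<prec> \<rho>"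
    "(\<lambda>j. max (\<rho> (Suc j)) (\<mu> (Suc j)) + min (\<rho> j) (\<mu> j) - \<nu> (Suc j)) \<prec>\<prec> \<mu>"
    if "\<rho> \<prec>\<prec> \<nu>" "\<mu> \<prec>\<prec> \<nu>" for \<nu>
  proof -
    have reflect: "a + b - c \<le> b \<and> a \<le> a + b - c" if "a \<le> c" "c \<le> b" for a b c :: nat
      using that by linarith
    have "max (\<rho> (Suc j)) (\<mu> (Suc j)) \<le> \<nu> (Suc j)" "\<nu> (Suc j) \<le> min (\<rho> j) (\<mu> j)" for j
      using that by (simp_all add: interlace_def)
    then have "max (\<rho> (Suc j)) (\<mu> (Suc j)) + min (\<rho> j) (\<mu> j) - \<nu> (Suc j) \<le> min (\<rho> j) (\<mu> j) \<and>
      max (\<rho> (Suc j)) (\<mu> (Suc j)) \<le> max (\<rho> (Suc j)) (\<mu> (Suc j)) + min (\<rho> j) (\<mu> j) - \<nu> (Suc j)" for j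
      using reflect by blast
    then show "(\<lambda>j. max (\<rho> (Suc j)) (\<mu> (Suc j)) + min (\<rho> j) (\<mu> j) - \<nu> (Suc j)) \<prec>\<prec> \<rho>"
      "(\<lambda>j. max (\<rho> (Suc j)) (\<mu> (Suc j)) + min (\<rho> j) (\<mu> j) - \<nu> (Suc j)) \<prec>\<prec> \<mu>"
      by (auto simp: interlace_def)
  qed
  then show ?case by auto
qed

text \<open>
  The reflections replace \<open>\<kappa> j\<close> by \<open>max (\<rho> (Suc j)) (\<mu> (Suc j)) + min (\<rho> j) (\<mu> j) - \<kappa> j\<close>; summing all
  maxima and minima gives every entry of \<open>\<rho>\<close> and of \<open>\<mu>\<close> once.
\<close>

lemma psize_toggle_up:
  assumes "\<kappa> \<prec>\<prec> \<rho>" "\<kappa> \<prec>\<prec> \<mu>" "finite (supp \<rho>)"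
  shows "psize (toggle_up \<rho> \<mu> (m, \<kappa>)) + psize \<kappa> = psize \<rho> + psize \<mu> + m"
proof -
  let ?\<nu> = "toggle_up \<rho> \<mu> (m, \<kappa>)"
  obtain K where K: "supp \<kappa> \<subseteq> {..<K}" using assms finite_supp_interlace finite_supp_iff by blast
  have l: "supp \<rho> \<subseteq> {..<Suc K}" "supp \<mu> \<subseteq> {..<Suc K}"
    using supp_interlace2[OF _ K] assms by auto
  have "\<rho> \<prec>\<prec> ?\<nu>"
    using bij_betwE[OF bij_betw_toggle_up, of \<rho> \<mu>] assms by auto
  from supp_interlace2[OF this l(1)] have n: "supp ?\<nu> \<subseteq> {..<Suc (Suc K)}" .
  have k: "supp \<kappa> \<subseteq> {..<Suc K}" and l': "supp \<rho> \<subseteq> {..<Suc (Suc K)}" "supp \<mu> \<subseteq> {..<Suc (Suc K)}"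
    using K l by auto
  have step: "?\<nu> (Suc j) + \<kappa> j = max (\<rho> (Suc j)) (\<mu> (Suc j)) + min (\<rho> j) (\<mu> j)" for j
  proof -
    have "\<kappa> j \<le> min (\<rho> j) (\<mu> j)" using assms by (auto simp: interlace_def)
    then show ?thesis by (simp add: toggle_up_def del: min.bounded_iff)
  qed
  have z: "\<rho> (Suc K) = 0" "\<mu> (Suc K) = 0" using l by (auto simp: supp_def)
  have "psize ?\<nu> + psize \<kappa> = ?\<nu> 0 + (\<Sum>j<Suc K. ?\<nu> (Suc j) + \<kappa> j)"
    by (simp add: psize_eq[OF n] psize_eq[OF k] sum.lessThan_Suc_shift[of _ "Suc K"] sum.distrib del: sum.lessThan_Suc)
  also have "\<dots> = m + (max (\<rho> 0) (\<mu> 0) + (\<Sum>j<Suc K. max (\<rho> (Suc j)) (\<mu> (Suc j)))) + (\<Sum>j<Suc K. min (\<rho> j) (\<mu> j))"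
    unfolding step sum.distrib by (simp add: toggle_up_def)
  also have "max (\<rho> 0) (\<mu> 0) + (\<Sum>j<Suc K. max (\<rho> (Suc j)) (\<mu> (Suc j))) = (\<Sum>j<Suc (Suc K). max (\<rho> j) (\<mu> j))"
    by (simp add: sum.lessThan_Suc_shift[of _ "Suc K"] del: sum.lessThan_Suc)
  also have "\<dots> = (\<Sum>j<Suc K. max (\<rho> j) (\<mu> j))" using z by simp
  also have "m + (\<Sum>j<Suc K. max (\<rho> j) (\<mu> j)) + (\<Sum>j<Suc K. min (\<rho> j) (\<mu> j))
      = m + (\<Sum>j<Suc K. max (\<rho> j) (\<mu> j) + min (\<rho> j) (\<mu> j))"
    unfolding sum.distrib by simp
  also have "(\<lambda>j. max (\<rho> j) (\<mu> j) + min (\<rho> j) (\<mu> j)) = (\<lambda>j. \<rho> j + \<mu> j)"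
    by auto
  finally show ?thesis by (simp add: psize_eq[OF l(1)] psize_eq[OF l(2)] sum.distrib)
qed

text \<open>
  The commutation relation of the transfer operators \<open>f \<mapsto> (\<lambda>\<rho>. \<Sum>\<nu>. skew_weight x \<rho> \<nu> * f \<nu>)\<close> and
  \<open>f \<mapsto> (\<lambda>\<nu>. \<Sum>\<mu>. skew_weight y \<mu> \<nu> * f \<mu>)\<close>, read off from the toggle bijection; the geometric series
  sums over the excess \<open>m\<close> of the first entry.
\<close>

lemma skew_weight_commute:
  assumes "finite (supp \<rho>)" "finite (supp \<mu>)"
  shows "(\<integral>\<^sup>+ \<nu>. skew_weight x \<rho> \<nu> * skew_weight y \<mu> \<nu> \<partial>count_space UNIV) =
         geometric_sum (x * y) * (\<integral>\<^sup>+ \<kappa>. skew_weight x \<kappa> \<mu> * skew_weight y \<kappa> \<rho> \<partial>count_space UNIV)"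
proof -
  let ?L = "{\<kappa>. \<kappa> \<prec>\<prec> \<rho> \<and> \<kappa> \<prec>\<prec> \<mu>}" and ?U = "{\<nu>. \<rho> \<prec>\<prec> \<nu> \<and> \<mu> \<prec>\<prec> \<nu>}"
  let ?g = "\<lambda>\<nu>. skew_weight x \<rho> \<nu> * skew_weight y \<mu> \<nu>"
  let ?h = "\<lambda>\<kappa>. skew_weight x \<kappa> \<mu> * skew_weight y \<kappa> \<rho>"
  have "(\<integral>\<^sup>+ \<nu>. ?g \<nu> \<partial>count_space UNIV) = (\<integral>\<^sup>+ \<nu>. ?g \<nu> \<partial>count_space ?U)"
    by (rule nn_integral_count_space_eq) (auto simp: skew_weight_def)
  also have "\<dots> = (\<integral>\<^sup>+ p. ?g (toggle_up \<rho> \<mu> p) \<partial>count_space (UNIV \<times> ?L))"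
    by (rule nn_integral_bij_count_space[OF bij_betw_toggle_up, symmetric])
  also have "\<dots> = (\<integral>\<^sup>+ p. (x * y) ^ fst p * ?h (snd p) \<partial>count_space (UNIV \<times> ?L))"
  proof (rule nn_integral_cong, safe, goal_cases)
    case (1 m \<kappa>)
    then have \<kappa>: "\<kappa> \<prec>\<prec> \<rho>" "\<kappa> \<prec>\<prec> \<mu>" by auto
    have "toggle_up \<rho> \<mu> (m, \<kappa>) \<in> ?U"
      using bij_betwE[OF bij_betw_toggle_up, of \<rho> \<mu>] \<kappa> by auto
    moreover note psize_toggle_up[OF \<kappa> assms(1), of m] psize_mono[OF \<kappa>(1) assms(1)]
      psize_mono[OF \<kappa>(2) assms(2)]
    ultimately have "psize (toggle_up \<rho> \<mu> (m, \<kappa>)) - psize \<rho> = psize \<mu> - psize \<kappa> + m"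
      "psize (toggle_up \<rho> \<mu> (m, \<kappa>)) - psize \<mu> = psize \<rho> - psize \<kappa> + m"
      by linarith+
    then show ?case using \<kappa> \<open>toggle_up \<rho> \<mu> (m, \<kappa>) \<in> ?U\<close>
      by (simp add: skew_weight_def power_add power_mult_distrib mult_ac)
  qed
  also have "\<dots> = (\<integral>\<^sup>+ p. (x * y) ^ fst p * ?h (snd p) \<partial>count_space UNIV)"
    by (rule nn_integral_count_space_eq) (auto simp: skew_weight_def)
  also have "\<dots> = (\<integral>\<^sup>+ m. \<integral>\<^sup>+ \<kappa>. (x * y) ^ m * ?h \<kappa> \<partial>count_space UNIV \<partial>count_space UNIV)"
    by (subst nn_integral_fst_count_space[symmetric]) simp
  also have "\<dots> = geometric_sum (x * y) * (\<integral>\<^sup>+ \<kappa>. ?h \<kappa> \<partial>count_space UNIV)"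
    by (simp add: geometric_sum_def nn_integral_cmult nn_integral_multc)
  finally show ?thesis .
qed

text \<open>
  The sum over all chains \<open>zero_seq = \<rho>\<^sub>0 \<prec>\<prec> \<rho>\<^sub>1 \<prec>\<prec> \<dots> \<prec>\<prec> \<rho>\<^sub>M = \<rho>\<close>, in which the step from \<open>\<rho>\<^sub>j\<close> to
  \<open>\<rho>\<^sub>j\<^sub>+\<^sub>1\<close> has weight \<open>y j\<close> to the number of added cells. This is the Schur polynomial of shape \<open>\<rho>\<close> in
  \<open>y 0, \<dots>, y (M - 1)\<close>.
\<close>

fun chain_weight :: "(nat \<Rightarrow> ennreal) \<Rightarrow> nat \<Rightarrow> (nat \<Rightarrow> nat) \<Rightarrow> ennreal" where
  "chain_weight y 0 \<rho> = (if \<rho> = zero_seq then 1 else 0)"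
| "chain_weight y (Suc M) \<rho> = (\<integral>\<^sup>+ \<mu>. skew_weight (y M) \<mu> \<rho> * chain_weight y M \<mu> \<partial>count_space UNIV)"

lemma finite_supp_chain_weight: "chain_weight y M \<rho> \<noteq> 0 \<Longrightarrow> finite (supp \<rho>)"
proof (induction M arbitrary: \<rho>)
  case (Suc M)
  then have "\<exists>\<mu>. skew_weight (y M) \<mu> \<rho> * chain_weight y M \<mu> \<noteq> 0"
    by (auto simp: nn_integral_0_iff_AE AE_count_space)
  then obtain \<mu> where "\<mu> \<prec>\<prec> \<rho>" "chain_weight y M \<mu> \<noteq> 0"
    by (auto simp: skew_weight_def split: if_splits)
  then show ?case using Suc.IH finite_supp_interlace by blast
qed (auto split: if_splits)

lemma nn_integral_count_space_swap:
  "(\<integral>\<^sup>+ x. \<integral>\<^sup>+ y. f x y \<partial>count_space UNIV \<partial>count_space UNIV) =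
   (\<integral>\<^sup>+ y. \<integral>\<^sup>+ x. f x y \<partial>count_space UNIV \<partial>count_space UNIV)"
  using nn_integral_fst_count_space[of "case_prod f"] nn_integral_snd_count_space[of "case_prod f"]
  by simp

text \<open>
  Schur functions are eigenvectors of the upward operator: the operator commutes with each downward
  step at the cost of one geometric series, and it fixes the indicator of the zero sequence, because only
  the zero sequence lies below the zero sequence.
\<close>

lemma chain_weight_eigen:
  assumes "finite (supp \<rho>)"
  shows "(\<integral>\<^sup>+ \<nu>. skew_weight x \<rho> \<nu> * chain_weight y M \<nu> \<partial>count_space UNIV) =
         (\<Prod>j<M. geometric_sum (x * y j)) * chain_weight y M \<rho>"
  using assms
proof (induction M arbitrary: \<rho>)
  case 0
  have "(\<integral>\<^sup>+ \<nu>. skew_weight x \<rho> \<nu> * chain_weight y 0 \<nu> \<partial>count_space UNIV) =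
      (\<integral>\<^sup>+ \<nu>. skew_weight x \<rho> \<nu> \<partial>count_space {zero_seq})"
    by (subst nn_integral_count_space_eq[where B = "{zero_seq}"]) (auto intro!: nn_integral_cong)
  also have "\<dots> = (if \<rho> = zero_seq then 1 else 0)"
    by (auto simp: nn_integral_count_space_finite skew_weight_def dest: interlace_zero)
  finally show ?case by simp
next
  case (Suc M)
  let ?W = "chain_weight y M" and ?k = "skew_weight x" and ?l = "skew_weight (y M)"
  have "(\<integral>\<^sup>+ \<nu>. ?k \<rho> \<nu> * chain_weight y (Suc M) \<nu> \<partial>count_space UNIV) =
     (\<integral>\<^sup>+ \<nu>. \<integral>\<^sup>+ \<mu>. ?k \<rho> \<nu> * ?l \<mu> \<nu> * ?W \<mu> \<partial>count_space UNIV \<partial>count_space UNIV)"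
    by (simp add: nn_integral_cmult mult.assoc)
  also have "\<dots> = (\<integral>\<^sup>+ \<mu>. (\<integral>\<^sup>+ \<nu>. ?k \<rho> \<nu> * ?l \<mu> \<nu> \<partial>count_space UNIV) * ?W \<mu> \<partial>count_space UNIV)"
    by (subst nn_integral_count_space_swap) (simp add: nn_integral_multc)
  also have "\<dots> = (\<integral>\<^sup>+ \<mu>. geometric_sum (x * y M) * (\<integral>\<^sup>+ \<kappa>. ?k \<kappa> \<mu> * ?l \<kappa> \<rho> \<partial>count_space UNIV) * ?W \<mu> \<partial>count_space UNIV)"
  proof (rule nn_integral_cong, goal_cases)
    case (1 \<mu>)
    show ?case
      using skew_weight_commute[OF Suc.prems, of \<mu> x "y M"] finite_supp_chain_weight[of y M \<mu>]
      by (cases "?W \<mu> = 0") auto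
  qed
  also have "\<dots> = geometric_sum (x * y M) * (\<integral>\<^sup>+ \<mu>. \<integral>\<^sup>+ \<kappa>. ?l \<kappa> \<rho> * (?k \<kappa> \<mu> * ?W \<mu>) \<partial>count_space UNIV \<partial>count_space UNIV)"
    by (simp add: nn_integral_cmult[symmetric] nn_integral_multc[symmetric] mult_ac)
  also have "\<dots> = geometric_sum (x * y M) * (\<integral>\<^sup>+ \<kappa>. ?l \<kappa> \<rho> * (\<integral>\<^sup>+ \<mu>. ?k \<kappa> \<mu> * ?W \<mu> \<partial>count_space UNIV) \<partial>count_space UNIV)"
    by (subst nn_integral_count_space_swap) (simp add: nn_integral_cmult)
  also have "\<dots> = geometric_sum (x * y M) * (\<integral>\<^sup>+ \<kappa>. ?l \<kappa> \<rho> * ((\<Prod>j<M. geometric_sum (x * y j)) * ?W \<kappa>) \<partial>count_space UNIV)"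
  proof -
    have "?l \<kappa> \<rho> * (\<integral>\<^sup>+ \<mu>. ?k \<kappa> \<mu> * ?W \<mu> \<partial>count_space UNIV) = ?l \<kappa> \<rho> * ((\<Prod>j<M. geometric_sum (x * y j)) * ?W \<kappa>)" for \<kappa>
    proof (cases "\<kappa> \<prec>\<prec> \<rho>")
      case True
      then show ?thesis using Suc finite_supp_interlace by auto
    qed (simp add: skew_weight_def)
    then show ?thesis by simp
  qed
  also have "\<dots> = (\<Prod>j<Suc M. geometric_sum (x * y j)) * chain_weight y (Suc M) \<rho>"
    by (simp add: nn_integral_cmult[symmetric] mult_ac)
  finally show ?case .
qed

lemma chain_weight_zero: "chain_weight y M zero_seq = 1"
proof (induction M)
  case (Suc M)
  have "chain_weight y (Suc M) zero_seq = (\<integral>\<^sup>+ \<mu>. skew_weight (y M) \<mu> zero_seq * chain_weight y M \<mu> \<partial>count_space {zero_seq})"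
    unfolding chain_weight.simps
    by (rule nn_integral_count_space_eq) (auto simp: skew_weight_def dest: interlace_zero split: if_splits)
  then show ?case using Suc by (simp add: nn_integral_count_space_finite skew_weight_def del: chain_weight.simps)
qed simp

text \<open>
  Each step of the first chain is moved over to the second factor, where it acts as the upward
  operator and produces one row of the product.
\<close>

theorem Cauchy_identity:
  "(\<integral>\<^sup>+ \<rho>. chain_weight x K \<rho> * chain_weight y M \<rho> \<partial>count_space UNIV) =
   (\<Prod>i<K. \<Prod>j<M. geometric_sum (x i * y j))"
proof (induction K)
  case 0
  have "(\<integral>\<^sup>+ \<rho>. chain_weight x 0 \<rho> * chain_weight y M \<rho> \<partial>count_space UNIV) =
      (\<integral>\<^sup>+ \<rho>. chain_weight y M \<rho> \<partial>count_space {zero_seq})"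
    by (subst nn_integral_count_space_eq[where B = "{zero_seq}"]) (auto intro!: nn_integral_cong)
  then show ?case by (simp add: nn_integral_count_space_finite chain_weight_zero)
next
  case (Suc K)
  have "(\<integral>\<^sup>+ \<rho>. chain_weight x (Suc K) \<rho> * chain_weight y M \<rho> \<partial>count_space UNIV) =
    (\<integral>\<^sup>+ \<rho>. \<integral>\<^sup>+ \<mu>. chain_weight x K \<mu> * (skew_weight (x K) \<mu> \<rho> * chain_weight y M \<rho>) \<partial>count_space UNIV \<partial>count_space UNIV)"
    by (simp add: nn_integral_cmult[symmetric] mult_ac)
  also have "\<dots> = (\<integral>\<^sup>+ \<mu>. chain_weight x K \<mu> * (\<integral>\<^sup>+ \<rho>. skew_weight (x K) \<mu> \<rho> * chain_weight y M \<rho> \<partial>count_space UNIV) \<partial>count_space UNIV)"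
    by (subst nn_integral_count_space_swap) (simp add: nn_integral_cmult)
  also have "\<dots> = (\<integral>\<^sup>+ \<mu>. chain_weight x K \<mu> * ((\<Prod>j<M. geometric_sum (x K * y j)) * chain_weight y M \<mu>) \<partial>count_space UNIV)"
  proof (rule nn_integral_cong, goal_cases)
    case (1 \<mu>)
    show ?case using chain_weight_eigen[of \<mu>] finite_supp_chain_weight[of x K \<mu>]
      by (cases "chain_weight x K \<mu> = 0") auto
  qed
  also have "\<dots> = (\<Prod>j<M. geometric_sum (x K * y j)) * (\<integral>\<^sup>+ \<mu>. chain_weight x K \<mu> * chain_weight y M \<mu> \<partial>count_space UNIV)"
    by (simp add: nn_integral_cmult[symmetric] mult_ac)
  finally show ?case by (simp add: Suc mult_ac)
qed

lemma chain_weight_cong: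
  "(\<And>j. j < M \<Longrightarrow> y j = z j) \<Longrightarrow> chain_weight y M \<rho> = chain_weight z M \<rho>"
  by (induction M arbitrary: \<rho>) auto

text \<open>
  Homogeneity of Schur functions, which turns powers attached to the steps of a chain into
  powers attached to its members.
\<close>

lemma chain_weight_scale:
  "chain_weight (\<lambda>j. c * y j) M \<rho> = c ^ psize \<rho> * chain_weight y M \<rho>"
proof (induction M arbitrary: \<rho>)
  case (Suc M)
  have "skew_weight (c * y M) \<mu> \<rho> * chain_weight (\<lambda>j. c * y j) M \<mu> =
      c ^ psize \<rho> * (skew_weight (y M) \<mu> \<rho> * chain_weight y M \<mu>)" for \<mu>
  proof (cases "\<mu> \<prec>\<prec> \<rho> \<and> chain_weight y M \<mu> \<noteq> 0")
    case True
    then have "finite (supp \<rho>)"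
      using finite_supp_chain_weight finite_supp_interlace by blast
    then have "psize \<mu> \<le> psize \<rho>" using True psize_mono by blast
    then have "c ^ psize \<rho> = c ^ (psize \<rho> - psize \<mu>) * c ^ psize \<mu>"
      by (simp flip: power_add)
    then show ?thesis
      using True by (simp add: Suc skew_weight_def power_mult_distrib mult_ac)
  qed (auto simp: Suc skew_weight_def)
  then show ?case by (simp add: nn_integral_cmult)
qed simp

section \<open>Diagonals of plane partitions and MacMahon's box formula\<close>

text \<open>
  The part of an array on and above its main diagonal, stored by diagonals: \<open>h d k\<close> is the \<open>k\<close>-th
  entry of the \<open>d\<close>-th diagonal. Monotone rows and columns amount to interlacing of consecutive
  diagonals.
\<close>

definition half_arrays :: "nat \<Rightarrow> (nat \<Rightarrow> nat \<Rightarrow> nat) set" where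
  "half_arrays M = {h. (\<forall>d. h (Suc d) \<prec>\<prec> h d) \<and> (\<forall>d\<ge>M. h d = zero_seq)}"

definition offdiag_size :: "nat \<Rightarrow> (nat \<Rightarrow> nat \<Rightarrow> nat) \<Rightarrow> nat" where
  "offdiag_size M h = (\<Sum>d<M. psize (h (Suc d)))"

lemma nn_integral_count_space_point:
  "(\<integral>\<^sup>+ x. f x * indicator {x. x = a \<and> P x} x \<partial>count_space UNIV) = (if P a then f a else (0 :: ennreal))"
proof -
  have "(\<integral>\<^sup>+ x. f x * indicator {x. x = a \<and> P x} x \<partial>count_space UNIV) =
      (\<integral>\<^sup>+ x. f x * indicator {x. x = a \<and> P x} x \<partial>count_space {a})"
    by (rule nn_integral_count_space_eq) (auto split: split_indicator)
  also have "\<dots> = f a * indicator {x. x = a \<and> P x} a"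
  proof -
    have "(\<integral>\<^sup>+ x. f x * indicator {x. x = a \<and> P x} x \<partial>count_space {a}) =
        (\<integral>\<^sup>+ x. f a * indicator {x. x = a \<and> P x} a \<partial>count_space {a})"
      by (rule nn_integral_cong) simp
    also have "\<dots> = f a * indicator {x. x = a \<and> P x} a"
      by (subst nn_integral_const) (simp add: emeasure_count_space)
    finally show ?thesis .
  qed
  finally show ?thesis by (simp split: split_indicator)
qed

lemma bij_betw_case_nat_half_arrays:
  "bij_betw (case_nat \<rho>) {h \<in> half_arrays M. h 0 \<prec>\<prec> \<rho>} {h \<in> half_arrays (Suc M). h 0 = \<rho>}"
proof (rule bij_betw_byWitness[where f' = "\<lambda>h d. h (Suc d)"], goal_cases)
  case 4
  then show ?case by (auto simp: half_arrays_def)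
qed (auto simp: half_arrays_def fun_eq_iff split: nat.splits)

text \<open>
  Step \<open>j\<close> of a chain carries the exponent \<open>M - 1 - j\<close>, so by summation by parts every member
  except the last contributes its size once: that is the size of the half array off its main
  diagonal. In the induction, prepending the last member is \<open>case_nat\<close>.
\<close>

lemma chain_weight_eq_half_arrays:
  "chain_weight (\<lambda>j. x ^ (M - 1 - j)) M \<rho> =
   (\<integral>\<^sup>+ h. x ^ offdiag_size M h \<partial>count_space {h \<in> half_arrays M. h 0 = \<rho>})"
proof (induction M arbitrary: \<rho>)
  case 0
  have "{h \<in> half_arrays 0. h 0 = \<rho>} = (if \<rho> = zero_seq then {\<lambda>_. zero_seq} else {})"
    by (auto simp: half_arrays_def fun_eq_iff)
  then show ?case by (simp add: offdiag_size_def nn_integral_count_space_finite)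
next
  case (Suc M)
  let ?I = "\<lambda>\<mu>. {h \<in> half_arrays M. h 0 = \<mu>}"
  have "chain_weight (\<lambda>j. x ^ (Suc M - 1 - j)) M \<mu> = chain_weight (\<lambda>j. x * x ^ (M - 1 - j)) M \<mu>" for \<mu>
    by (rule chain_weight_cong) (auto simp: Suc_diff_Suc simp flip: power_Suc)
  then have "chain_weight (\<lambda>j. x ^ (Suc M - 1 - j)) M \<mu> = x ^ psize \<mu> * (\<integral>\<^sup>+ h. x ^ offdiag_size M h \<partial>count_space (?I \<mu>))" for \<mu>
    using Suc[of \<mu>] by (simp add: chain_weight_scale)
  then have "chain_weight (\<lambda>j. x ^ (Suc M - 1 - j)) (Suc M) \<rho> =
     (\<integral>\<^sup>+ \<mu>. skew_weight 1 \<mu> \<rho> * (x ^ psize \<mu> * (\<integral>\<^sup>+ h. x ^ offdiag_size M h * indicator (?I \<mu>) h \<partial>count_space UNIV)) \<partial>count_space UNIV)"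
    by (simp add: nn_integral_count_space_indicator)
  also have "\<dots> = (\<integral>\<^sup>+ \<mu>. \<integral>\<^sup>+ h. skew_weight 1 \<mu> \<rho> * x ^ psize \<mu> * x ^ offdiag_size M h * indicator (?I \<mu>) h \<partial>count_space UNIV \<partial>count_space UNIV)"
    by (simp add: nn_integral_cmult[symmetric] mult_ac)
  also have "\<dots> = (\<integral>\<^sup>+ h. \<integral>\<^sup>+ \<mu>. skew_weight 1 \<mu> \<rho> * x ^ psize \<mu> * x ^ offdiag_size M h * indicator (?I \<mu>) h \<partial>count_space UNIV \<partial>count_space UNIV)"
    by (rule nn_integral_count_space_swap)
  also have "\<dots> = (\<integral>\<^sup>+ h. x ^ (psize (h 0) + offdiag_size M h) * indicator {h \<in> half_arrays M. h 0 \<prec>\<prec> \<rho>} h \<partial>count_space UNIV)"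
  proof (rule nn_integral_cong, goal_cases)
    case (1 h)
    have "indicator (?I \<mu>) h = (indicator {\<mu>. \<mu> = h 0 \<and> h \<in> half_arrays M} \<mu> :: ennreal)" for \<mu>
      by (auto split: split_indicator)
    then show ?case
      using nn_integral_count_space_point[of "\<lambda>\<mu>. skew_weight 1 \<mu> \<rho> * x ^ psize \<mu> * x ^ offdiag_size M h" "h 0" "\<lambda>_. h \<in> half_arrays M"]
      by (auto simp: skew_weight_def power_add)
  qed
  also have "\<dots> = (\<integral>\<^sup>+ h. x ^ (psize (h 0) + offdiag_size M h) \<partial>count_space {h \<in> half_arrays M. h 0 \<prec>\<prec> \<rho>})"
    by (simp add: nn_integral_count_space_indicator)
  also have "\<dots> = (\<integral>\<^sup>+ h. x ^ offdiag_size (Suc M) (case_nat \<rho> h) \<partial>count_space {h \<in> half_arrays M. h 0 \<prec>\<prec> \<rho>})"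
    by (simp add: offdiag_size_def sum.lessThan_Suc_shift del: sum.lessThan_Suc)
  also have "\<dots> = (\<integral>\<^sup>+ h. x ^ offdiag_size (Suc M) h \<partial>count_space {h \<in> half_arrays (Suc M). h 0 = \<rho>})"
    by (rule nn_integral_bij_count_space[OF bij_betw_case_nat_half_arrays])
  finally show ?case .
qed

text \<open>
  Restricting the support to a box makes the chains of diagonals finite, and an array of size \<open>n\<close>
  fits into the box with \<open>M = n\<close>.
\<close>

definition box_arrays :: "nat \<Rightarrow> (nat \<Rightarrow> nat \<Rightarrow> nat) set" where
  "box_arrays M = {\<pi>. (\<forall>i. antimono (\<lambda>j. \<pi> i j)) \<and> (\<forall>j. antimono (\<lambda>i. \<pi> i j)) \<and>
     (\<forall>i j. M \<le> i \<or> M \<le> j \<longrightarrow> \<pi> i j = 0)}"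

definition array_size :: "(nat \<Rightarrow> nat \<Rightarrow> nat) \<Rightarrow> nat" where
  "array_size \<pi> = (\<Sum>(i, j) \<in> {(i, j). \<pi> i j \<noteq> 0}. \<pi> i j)"

definition upper_diagonals :: "(nat \<Rightarrow> nat \<Rightarrow> nat) \<Rightarrow> nat \<Rightarrow> nat \<Rightarrow> nat" where
  "upper_diagonals \<pi> d k = \<pi> k (k + d)"

definition lower_diagonals :: "(nat \<Rightarrow> nat \<Rightarrow> nat) \<Rightarrow> nat \<Rightarrow> nat \<Rightarrow> nat" where
  "lower_diagonals \<pi> d k = \<pi> (k + d) k"

lemma upper_diagonals_half_array: "\<pi> \<in> box_arrays M \<Longrightarrow> upper_diagonals \<pi> \<in> half_arrays M"
  unfolding half_arrays_def box_arrays_def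
  by (auto simp: interlace_def upper_diagonals_def zero_seq_def antimono_def)

lemma lower_diagonals_half_array: "\<pi> \<in> box_arrays M \<Longrightarrow> lower_diagonals \<pi> \<in> half_arrays M"
  unfolding half_arrays_def box_arrays_def
  by (auto simp: interlace_def lower_diagonals_def zero_seq_def antimono_def)

text \<open>
  Interlacing bounds an entry by the first entry of a diagonal further out, hence the support of a
  half array lies in a triangle.
\<close>

lemma half_array_zero:
  assumes "h \<in> half_arrays M" "M \<le> k + d"
  shows "h d k = 0"
proof -
  have "h d k \<le> h (d + k) 0" for k d
  proof (induction k arbitrary: d)
    case (Suc k)
    have "h d (Suc k) \<le> h (Suc d) k" using assms(1) by (simp add: half_arrays_def interlace_def)
    then show ?case using Suc[of "Suc d"] by simp
  qed simp
  moreover have "h (d + k) 0 = 0" using assms by (simp add: half_arrays_def zero_seq_def)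
  ultimately show ?thesis by (metis le_zero_eq)
qed

definition glue :: "(nat \<Rightarrow> nat \<Rightarrow> nat) \<times> (nat \<Rightarrow> nat \<Rightarrow> nat) \<Rightarrow> nat \<Rightarrow> nat \<Rightarrow> nat" where
  "glue = (\<lambda>(h, g) i j. if i \<le> j then h (j - i) i else g (i - j) j)"

lemma glue_box_array:
  assumes h: "h \<in> half_arrays M" and g: "g \<in> half_arrays M" and eq: "h 0 = g 0"
  shows "glue (h, g) \<in> box_arrays M"
proof -
  have il: "h (Suc d) k \<le> h d k" "h d (Suc k) \<le> h (Suc d) k"
    "g (Suc d) k \<le> g d k" "g d (Suc k) \<le> g (Suc d) k" for d k
    using h g by (auto simp: half_arrays_def interlace_def)
  have "glue (h, g) i (Suc j) \<le> glue (h, g) i j" for i j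
  proof (cases "i \<le> j")
    case True
    then show ?thesis using il(1)[of "j - i" i] by (simp add: glue_def Suc_diff_le)
  next
    case False
    then have "glue (h, g) i (Suc j) = g (i - Suc j) (Suc j)"
      by (cases "i = Suc j") (auto simp: glue_def eq)
    then show ?thesis using il(4)[of "i - Suc j" j] False by (simp add: glue_def Suc_diff_Suc)
  qed
  moreover have "glue (h, g) (Suc i) j \<le> glue (h, g) i j" for i j
  proof (cases "i < j")
    case True
    then show ?thesis using il(2)[of "j - Suc i" i] by (simp add: glue_def Suc_diff_Suc)
  next
    case False
    then have "glue (h, g) i j = g (i - j) j"
      by (cases "i = j") (auto simp: glue_def eq)
    then show ?thesis using il(3)[of "i - j" j] False by (simp add: glue_def Suc_diff_le)
  qed
  moreover have "glue (h, g) i j = 0" if "M \<le> i \<or> M \<le> j" for i j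
    using that half_array_zero[OF h, of i "j - i"] half_array_zero[OF g, of j "i - j"]
    by (auto simp: glue_def)
  ultimately show ?thesis by (auto simp: box_arrays_def antimono_iff_le_Suc)
qed

lemma bij_betw_glue:
  "bij_betw glue {(h, g). h \<in> half_arrays M \<and> g \<in> half_arrays M \<and> h 0 = g 0} (box_arrays M)"
proof (rule bij_betw_byWitness[where f' = "\<lambda>\<pi>. (upper_diagonals \<pi>, lower_diagonals \<pi>)"], goal_cases)
  case 1
  then show ?case by (auto simp: upper_diagonals_def lower_diagonals_def glue_def fun_eq_iff)
next
  case 2
  then show ?case by (auto simp: upper_diagonals_def lower_diagonals_def glue_def fun_eq_iff)
next
  case 3
  then show ?case using glue_box_array by auto
next
  case 4
  then show ?case
    using upper_diagonals_half_array lower_diagonals_half_array by (auto simp: upper_diagonals_def lower_diagonals_def)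
qed

lemma array_size_eq:
  assumes "\<pi> \<in> box_arrays M"
  shows "array_size \<pi> = psize (upper_diagonals \<pi> 0) + offdiag_size M (upper_diagonals \<pi>) + offdiag_size M (lower_diagonals \<pi>)"
proof -
  let ?S = "{(i, j). \<pi> i j \<noteq> 0}"
  have z: "\<pi> i j = 0" if "M \<le> i \<or> M \<le> j" for i j
    using that assms by (auto simp: box_arrays_def)
  have S: "?S \<subseteq> {..<M} \<times> {..<M}"
    using z by clarsimp (metis not_le neq0_conv)
  then have fin: "finite ?S" by (rule finite_subset) auto
  have fins: "finite (supp (upper_diagonals \<pi> d))" "finite (supp (lower_diagonals \<pi> d))" for d
  proof -
    have "supp (upper_diagonals \<pi> d) \<subseteq> {..<M}" "supp (lower_diagonals \<pi> d) \<subseteq> {..<M}"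
      using z by (auto simp: supp_def upper_diagonals_def lower_diagonals_def) (metis not_le neq0_conv)+
    then show "finite (supp (upper_diagonals \<pi> d))" "finite (supp (lower_diagonals \<pi> d))"
      by (auto intro: finite_subset)
  qed
  let ?D = "(\<lambda>k. (k, k)) ` supp (upper_diagonals \<pi> 0)"
  let ?U = "(\<lambda>(d, k). (k, k + Suc d)) ` (SIGMA d:{..<M}. supp (upper_diagonals \<pi> (Suc d)))"
  let ?L = "(\<lambda>(d, k). (k + Suc d, k)) ` (SIGMA d:{..<M}. supp (lower_diagonals \<pi> (Suc d)))"
  have split: "?S = ?D \<union> ?U \<union> ?L"
  proof (intro equalityI subsetI)
    fix p assume "p \<in> ?S"
    then obtain i j where p: "p = (i, j)" "\<pi> i j \<noteq> 0" by auto
    then have ij: "i < M" "j < M" using S by auto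
    consider "i = j" | "i < j" | "j < i" by linarith
    then show "p \<in> ?D \<union> ?U \<union> ?L"
    proof cases
      case 1
      then have "p \<in> ?D" using p by (auto simp: supp_def upper_diagonals_def)
      then show ?thesis by simp
    next
      case 2
      then have "p = (\<lambda>(d, k). (k, k + Suc d)) (j - Suc i, i)" "(j - Suc i, i) \<in> (SIGMA d:{..<M}. supp (upper_diagonals \<pi> (Suc d)))"
        using p ij by (auto simp: supp_def upper_diagonals_def)
      then have "p \<in> ?U" by (rule image_eqI)
      then show ?thesis by simp
    next
      case 3
      then have "p = (\<lambda>(d, k). (k + Suc d, k)) (i - Suc j, j)" "(i - Suc j, j) \<in> (SIGMA d:{..<M}. supp (lower_diagonals \<pi> (Suc d)))"
        using p ij by (auto simp: supp_def lower_diagonals_def)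
      then have "p \<in> ?L" by (rule image_eqI)
      then show ?thesis by simp
    qed
  qed (auto simp: supp_def upper_diagonals_def lower_diagonals_def)
  have disj: "(?D \<union> ?U) \<inter> ?L = {}" "?D \<inter> ?U = {}" by auto
  have finD: "finite ?D" "finite ?U" "finite ?L" using fins by auto
  have "array_size \<pi> = (\<Sum>(i, j) \<in> ?D. \<pi> i j) + (\<Sum>(i, j) \<in> ?U. \<pi> i j) + (\<Sum>(i, j) \<in> ?L. \<pi> i j)"
    unfolding array_size_def split using finD disj by (simp add: sum.union_disjoint)
  also have "(\<Sum>(i, j) \<in> ?D. \<pi> i j) = psize (upper_diagonals \<pi> 0)"
    by (subst sum.reindex) (auto simp: inj_on_def psize_def upper_diagonals_def)
  also have "(\<Sum>(i, j) \<in> ?U. \<pi> i j) = offdiag_size M (upper_diagonals \<pi>)"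
    using fins by (subst sum.reindex) (auto simp: inj_on_def psize_def upper_diagonals_def offdiag_size_def sum.Sigma case_prod_beta intro!: sum.cong)
  also have "(\<Sum>(i, j) \<in> ?L. \<pi> i j) = offdiag_size M (lower_diagonals \<pi>)"
    using fins by (subst sum.reindex) (auto simp: inj_on_def psize_def lower_diagonals_def offdiag_size_def sum.Sigma case_prod_beta intro!: sum.cong)
  finally show ?thesis .
qed

text \<open>
  The main diagonal is counted once, by attaching one extra factor \<open>x\<close> to each variable of one of the
  two Schur functions; then the Cauchy identity applies with \<open>x\<^sub>i * y\<^sub>j = x ^ (i + j + 1)\<close> up to the order
  of the factors.
\<close>

theorem MacMahon_box:
  "(\<integral>\<^sup>+ \<pi>. x ^ array_size \<pi> \<partial>count_space (box_arrays M)) = (\<Prod>i<M. \<Prod>j<M. geometric_sum (x ^ (i + j + 1)))"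
proof -
  let ?P = "{(h, g). h \<in> half_arrays M \<and> g \<in> half_arrays M \<and> h 0 = g 0}"
  let ?C = "chain_weight (\<lambda>j. x ^ (M - 1 - j)) M"
  let ?w = "\<lambda>h. x ^ offdiag_size M h"
  let ?I = "\<lambda>\<rho>. {h \<in> half_arrays M. h 0 = \<rho>}"
  have r: "(\<Prod>j<M. f (M - 1 - j)) = (\<Prod>j<M. f j)" for f :: "nat \<Rightarrow> ennreal"
    using prod.nat_diff_reindex[of f M] by simp
  have up: "upper_diagonals (glue p) = fst p" "lower_diagonals (glue p) = snd p" if "p \<in> ?P" for p
    using that by (auto simp: upper_diagonals_def lower_diagonals_def glue_def fun_eq_iff)
  have "(\<integral>\<^sup>+ \<pi>. x ^ array_size \<pi> \<partial>count_space (box_arrays M)) =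
     (\<integral>\<^sup>+ p. x ^ array_size (glue p) \<partial>count_space ?P)"
    by (rule nn_integral_bij_count_space[OF bij_betw_glue, symmetric])
  also have "\<dots> = (\<integral>\<^sup>+ p. x ^ psize (fst p 0) * ?w (fst p) * ?w (snd p) \<partial>count_space ?P)"
  proof (rule nn_integral_cong, goal_cases)
    case (1 p)
    then have "glue p \<in> box_arrays M" using bij_betwE[OF bij_betw_glue] by auto
    from array_size_eq[OF this] show ?case using 1 up[of p] by (simp add: power_add)
  qed
  also have "\<dots> = (\<integral>\<^sup>+ p. x ^ psize (fst p 0) * ?w (fst p) * ?w (snd p) * indicator ?P p \<partial>count_space UNIV)"
    by (simp add: nn_integral_count_space_indicator)
  also have "\<dots> = (\<integral>\<^sup>+ h. \<integral>\<^sup>+ g. x ^ psize (h 0) * ?w h * ?w g * indicator ?P (h, g) \<partial>count_space UNIV \<partial>count_space UNIV)"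
    by (subst nn_integral_fst_count_space[symmetric]) simp
  also have "\<dots> = (\<integral>\<^sup>+ h. (x ^ psize (h 0) * ?C (h 0)) * ?w h * indicator (half_arrays M) h \<partial>count_space UNIV)"
  proof (rule nn_integral_cong, goal_cases)
    case (1 h)
    have "(\<integral>\<^sup>+ g. x ^ psize (h 0) * ?w h * ?w g * indicator ?P (h, g) \<partial>count_space UNIV) =
      (\<integral>\<^sup>+ g. (x ^ psize (h 0) * ?w h * indicator (half_arrays M) h) * (?w g * indicator (?I (h 0)) g) \<partial>count_space UNIV)"
      by (intro nn_integral_cong) (auto split: split_indicator)
    also have "\<dots> = (x ^ psize (h 0) * ?w h * indicator (half_arrays M) h) * ?C (h 0)"
      unfolding chain_weight_eq_half_arrays by (simp add: nn_integral_cmult nn_integral_count_space_indicator)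
    finally show ?case by (simp add: mult_ac)
  qed
  also have "\<dots> = (\<integral>\<^sup>+ h. \<integral>\<^sup>+ \<rho>. (x ^ psize \<rho> * ?C \<rho>) * (?w h * indicator (?I \<rho>) h) \<partial>count_space UNIV \<partial>count_space UNIV)"
  proof (rule nn_integral_cong, goal_cases)
    case (1 h)
    have "indicator (?I \<rho>) h = (indicator {\<rho>. \<rho> = h 0 \<and> h \<in> half_arrays M} \<rho> :: ennreal)" for \<rho>
      by (auto split: split_indicator)
    then show ?case
      using nn_integral_count_space_point[of "\<lambda>\<rho>. (x ^ psize \<rho> * ?C \<rho>) * ?w h" "h 0" "\<lambda>_. h \<in> half_arrays M"]
      by (auto simp: mult_ac)
  qed
  also have "\<dots> = (\<integral>\<^sup>+ \<rho>. \<integral>\<^sup>+ h. (x ^ psize \<rho> * ?C \<rho>) * (?w h * indicator (?I \<rho>) h) \<partial>count_space UNIV \<partial>count_space UNIV)"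
    by (rule nn_integral_count_space_swap)
  also have "\<dots> = (\<integral>\<^sup>+ \<rho>. (x ^ psize \<rho> * ?C \<rho>) * ?C \<rho> \<partial>count_space UNIV)"
    unfolding chain_weight_eq_half_arrays by (simp add: nn_integral_cmult nn_integral_count_space_indicator)
  also have "\<dots> = (\<integral>\<^sup>+ \<rho>. chain_weight (\<lambda>i. x * x ^ (M - 1 - i)) M \<rho> * ?C \<rho> \<partial>count_space UNIV)"
    by (simp add: chain_weight_scale)
  also have "\<dots> = (\<Prod>i<M. \<Prod>j<M. geometric_sum (x * x ^ (M - 1 - i) * x ^ (M - 1 - j)))"
    by (rule Cauchy_identity)
  also have "\<dots> = (\<Prod>i<M. \<Prod>j<M. geometric_sum (x ^ ((M - 1 - i) + (M - 1 - j) + 1)))"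
    by (simp only: power_add power_one_right mult_ac)
  also have "\<dots> = (\<Prod>i<M. \<Prod>j<M. geometric_sum (x ^ ((M - 1 - i) + j + 1)))"
    by (rule prod.cong[OF refl], rule r[of "\<lambda>j. geometric_sum (x ^ ((M - 1 - i) + j + 1))" for i])
  also have "\<dots> = (\<Prod>i<M. \<Prod>j<M. geometric_sum (x ^ (i + j + 1)))"
    by (rule r[of "\<lambda>i. \<Prod>j<M. geometric_sum (x ^ (i + j + 1))"])
  finally show ?thesis .
qed

section \<open>The generating function of plane partitions\<close>

text \<open>
  The coefficients \<open>\<sigma>\<^sub>2(N) / N\<close> of the logarithm of MacMahon's product. For \<open>N = 0\<close> the value is \<open>0\<close>
  because of the division by zero, as the series requires.
\<close>

definition sigma_weight :: "nat \<Rightarrow> real" where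
  "sigma_weight N = (\<Sum>k | k dvd N. (real k)\<^sup>2) / real N"

lemma sigma_weight_0 [simp]: "sigma_weight 0 = 0"
  by (simp add: sigma_weight_def)

lemma sigma_weight_ge: "real N \<le> sigma_weight N"
proof (cases "N = 0")
  case False
  have "(real N)\<^sup>2 \<le> (\<Sum>k | k dvd N. (real k)\<^sup>2)"
    using False by (intro member_le_sum) auto
  then show ?thesis using False
    by (simp add: sigma_weight_def field_simps power2_eq_square)
qed simp

lemma sum_inverse_squares_le: "(\<Sum>m=1..Suc n. 1 / (real m)\<^sup>2) \<le> 2 - 1 / real (Suc n)"
proof (induction n)
  case (Suc n)
  have "1 / (real (Suc (Suc n)))\<^sup>2 \<le> 1 / real (Suc n) - 1 / real (Suc (Suc n))"
  proof -
    have "1 / (real (Suc (Suc n)))\<^sup>2 \<le> 1 / (real (Suc n) * real (Suc (Suc n)))"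
      by (intro divide_left_mono) (auto simp: power2_eq_square)
    also have "\<dots> = 1 / real (Suc n) - 1 / real (Suc (Suc n))"
      by (simp add: field_simps)
    finally show ?thesis .
  qed
  then show ?case using Suc by simp
qed simp

text \<open>
  Divisors come in pairs \<open>k * m = N\<close>, so \<open>\<sigma>\<^sub>2(N) \<le> N\<^sup>2 * (\<Sum>m. 1 / m\<^sup>2)\<close>.
\<close>

lemma sigma_weight_le: "sigma_weight N \<le> 2 * real N"
proof (cases N)
  case (Suc n)
  have "(\<Sum>k | k dvd N. (real k)\<^sup>2) = (\<Sum>m | m dvd N. (real N / real m)\<^sup>2)"
    by (rule sum.reindex_bij_witness[where i = "\<lambda>k. N div k" and j = "\<lambda>k. N div k"])
       (use Suc in \<open>auto simp: real_of_nat_div div_dvd_iff_mult elim!: dvdE\<close>)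
  also have "\<dots> \<le> (\<Sum>m=1..Suc n. (real N / real m)\<^sup>2)"
  proof (rule sum_mono2)
    have "1 \<le> m \<and> m \<le> Suc n" if "m dvd N" for m
      using Suc that dvd_imp_le[of m N] by (cases "m = 0") auto
    then show "{m. m dvd N} \<subseteq> {1..Suc n}" by auto
  qed auto
  also have "\<dots> = (real N)\<^sup>2 * (\<Sum>m=1..Suc n. 1 / (real m)\<^sup>2)"
    by (simp add: sum_distrib_left power_divide del: sum.cl_ivl_Suc)
  also have "\<dots> \<le> (real N)\<^sup>2 * 2"
    using sum_inverse_squares_le[of n] by (intro mult_left_mono) (auto intro: order_trans)
  finally show ?thesis using Suc
    by (simp add: sigma_weight_def field_simps power2_eq_square)
qed simp

lemma sigma_weight_nonneg: "0 \<le> sigma_weight N"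
  by (simp add: sigma_weight_def sum_nonneg)

lemma summable_power_times_geometric:
  fixes x :: real
  assumes "0 \<le> x" "x < 1"
  shows "summable (\<lambda>n. real n ^ k * x ^ n)"
proof -
  have "(\<lambda>n. (real (Suc n) / real n) ^ k * x) \<longlonglongrightarrow> 1 ^ k * x"
    by (intro tendsto_intros LIMSEQ_Suc_n_over_n)
  then have "\<forall>\<^sub>F n in sequentially. (real (Suc n) / real n) ^ k * x < (1 + x) / 2"
    by (rule order_tendstoD(2)) (use assms in simp)
  then have "\<forall>\<^sub>F n in sequentially. n > 0 \<and> (real (Suc n) / real n) ^ k * x < (1 + x) / 2"
    using eventually_gt_at_top[of 0] by eventually_elim simp
  then obtain N where N: "\<And>n. n \<ge> N \<Longrightarrow> n > 0 \<and> (real (Suc n) / real n) ^ k * x < (1 + x) / 2"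
    by (auto simp: eventually_at_top_linorder)
  show ?thesis
  proof (rule summable_ratio_test[where c = "(1 + x) / 2" and N = N])
    fix n assume "n \<ge> N"
    with N have n: "n > 0" "(real (Suc n) / real n) ^ k * x \<le> (1 + x) / 2" by (auto intro: less_imp_le)
    have "norm (real (Suc n) ^ k * x ^ Suc n) = ((real (Suc n) / real n) ^ k * x) * (real n ^ k * x ^ n)"
      using n assms by (simp add: power_divide abs_mult)
    also have "\<dots> \<le> (1 + x) / 2 * (real n ^ k * x ^ n)"
      using n(2) assms by (intro mult_right_mono) auto
    finally show "norm (real (Suc n) ^ k * x ^ Suc n) \<le> (1 + x) / 2 * norm (real n ^ k * x ^ n)"
      using assms by (simp add: abs_mult)
  qed (use assms in simp)
qed

lemma summable_sigma_weight_moment: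
  fixes x :: real
  assumes "0 \<le> x" "x < 1"
  shows "summable (\<lambda>n. sigma_weight n * real n ^ k * x ^ n)"
proof (rule summable_comparison_test')
  show "summable (\<lambda>n. 2 * (real n ^ Suc k * x ^ n))"
    using summable_power_times_geometric[OF assms] by (rule summable_mult)
  fix n
  have "sigma_weight n * (real n ^ k * x ^ n) \<le> 2 * real n * (real n ^ k * x ^ n)"
    using assms by (intro mult_right_mono sigma_weight_le) auto
  then show "norm (sigma_weight n * real n ^ k * x ^ n) \<le> 2 * (real n ^ Suc k * x ^ n)"
    using assms sigma_weight_nonneg[of n] by (simp add: abs_mult mult_ac)
qed

lemma summable_sigma_weight:
  fixes x :: real
  assumes "0 \<le> x" "x < 1"
  shows "summable (\<lambda>n. sigma_weight n * x ^ n)"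
  using summable_sigma_weight_moment[OF assms, of 0] by simp

lemma sums_minus_log:
  fixes z :: real
  assumes "0 \<le> z" "z < 1"
  shows "(\<lambda>m. z ^ m / real m) sums (- ln (1 - z))"
  using sums_minus[OF ln_series'[of "- z"]] assms by simp

text \<open>
  Expanding each logarithm yields the terms \<open>k * x ^ (k * m) / m\<close>, which are regrouped according to
  \<open>N = k * m\<close>. All terms are nonnegative, so the rearrangement takes place in \<open>ennreal\<close>.
\<close>

lemma sum_log_eq_sum_sigma_weight:
  fixes x :: real
  assumes "0 \<le> x" "x < 1"
  shows "(\<Sum>k. ennreal (real k * - ln (1 - x ^ k))) = (\<Sum>N. ennreal (sigma_weight N * x ^ N))"
proof -
  let ?g = "\<lambda>k m. ennreal (real k * (x ^ (k * m) / real m))"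
  have g: "(\<integral>\<^sup>+ m. ?g k m \<partial>count_space UNIV) = ennreal (real k * - ln (1 - x ^ k))" for k
  proof (cases "k = 0")
    case False
    then have xk: "0 \<le> x ^ k" "x ^ k < 1" using assms by (auto simp: power_less_one_iff)
    have "(\<lambda>m. real k * ((x ^ k) ^ m / real m)) sums (real k * - ln (1 - x ^ k))"
      by (rule sums_mult[OF sums_minus_log[OF xk]])
    then have *: "(\<lambda>m. real k * (x ^ (k * m) / real m)) sums (real k * - ln (1 - x ^ k))"
      by (simp add: power_mult)
    show ?thesis unfolding nn_integral_count_space_nat
      by (rule suminf_ennreal_eq[OF _ *]) (use assms in simp)
  qed simp
  have "(\<Sum>k. ennreal (real k * - ln (1 - x ^ k))) = (\<integral>\<^sup>+ k. \<integral>\<^sup>+ m. ?g k m \<partial>count_space UNIV \<partial>count_space UNIV)"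
    by (simp only: nn_integral_count_space_nat[symmetric] g)
  also have "\<dots> = (\<integral>\<^sup>+ k. \<integral>\<^sup>+ m. \<integral>\<^sup>+ N. ?g k m * indicator {N. N = k * m \<and> True} N \<partial>count_space UNIV \<partial>count_space UNIV \<partial>count_space UNIV)"
    by (subst nn_integral_count_space_point) simp
  also have "\<dots> = (\<integral>\<^sup>+ k. \<integral>\<^sup>+ N. \<integral>\<^sup>+ m. ?g k m * indicator {N. N = k * m \<and> True} N \<partial>count_space UNIV \<partial>count_space UNIV \<partial>count_space UNIV)"
    by (rule nn_integral_cong, rule nn_integral_count_space_swap)
  also have "\<dots> = (\<integral>\<^sup>+ N. \<integral>\<^sup>+ k. \<integral>\<^sup>+ m. ?g k m * indicator {N. N = k * m \<and> True} N \<partial>count_space UNIV \<partial>count_space UNIV \<partial>count_space UNIV)"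
    by (rule nn_integral_count_space_swap)
  also have "\<dots> = (\<integral>\<^sup>+ N. ennreal (sigma_weight N * x ^ N) \<partial>count_space UNIV)"
  proof (rule nn_integral_cong, goal_cases)
    case (1 N)
    show ?case
    proof (cases "N = 0")
      case True
      have "(\<integral>\<^sup>+ m. ?g k m * indicator {N. N = k * m \<and> True} N \<partial>count_space UNIV) = (\<integral>\<^sup>+ m. 0 \<partial>count_space (UNIV :: nat set))" for k
        by (rule nn_integral_cong) (use True in \<open>auto split: split_indicator\<close>)
      then show ?thesis using True by simp
    next
      case False
      have m: "(\<integral>\<^sup>+ m. ?g k m * indicator {N. N = k * m \<and> True} N \<partial>count_space UNIV)
          = ennreal ((real k)\<^sup>2 * x ^ N / real N) * indicator {k. k dvd N} k" for k
      proof (cases "k dvd N")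
        case True
        then obtain m0 where m0: "N = k * m0" by (elim dvdE)
        then have "k \<noteq> 0" "m0 \<noteq> 0" using False by auto
        then have "indicator {N. N = k * m \<and> True} N = (indicator {m. m = m0 \<and> True} m :: ennreal)" for m
          using m0 by (auto split: split_indicator)
        then have "(\<integral>\<^sup>+ m. ?g k m * indicator {N. N = k * m \<and> True} N \<partial>count_space UNIV) = ?g k m0"
          by (simp only: nn_integral_count_space_point if_True)
        also have "real k * (x ^ (k * m0) / real m0) = (real k)\<^sup>2 * x ^ N / real N"
          using m0 \<open>k \<noteq> 0\<close> \<open>m0 \<noteq> 0\<close> by (simp add: field_simps power2_eq_square)
        finally show ?thesis using True by simp
      next
        case False
        have "(\<integral>\<^sup>+ m. ?g k m * indicator {N. N = k * m \<and> True} N \<partial>count_space UNIV) = (\<integral>\<^sup>+ m. 0 \<partial>count_space (UNIV :: nat set))"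
          by (rule nn_integral_cong) (use False in \<open>auto split: split_indicator\<close>)
        then show ?thesis using False by simp
      qed
      have "(\<integral>\<^sup>+ k. \<integral>\<^sup>+ m. ?g k m * indicator {N. N = k * m \<and> True} N \<partial>count_space UNIV \<partial>count_space UNIV)
         = (\<integral>\<^sup>+ k. ennreal ((real k)\<^sup>2 * x ^ N / real N) \<partial>count_space {k. k dvd N})"
        unfolding m by (simp add: nn_integral_count_space_indicator)
      also have "\<dots> = (\<Sum>k | k dvd N. ennreal ((real k)\<^sup>2 * x ^ N / real N))"
        using False by (simp add: nn_integral_count_space_finite)
      also have "\<dots> = ennreal (sigma_weight N * x ^ N)"
        using assms by (simp add: sum_ennreal sigma_weight_def sum_distrib_right sum_divide_distrib)
      finally show ?thesis .
    qed
  qed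
  finally show ?thesis by (simp add: nn_integral_count_space_nat)
qed

lemma sums_of_suminf_ennreal:
  assumes "\<And>i. 0 \<le> f i" "0 \<le> c" "(\<Sum>i. ennreal (f i)) = ennreal c"
  shows "f sums c"
proof -
  have top: "(\<Sum>i. ennreal (f i)) \<noteq> top" using assms(3) by simp
  have summ: "summable f" by (rule summable_suminf_not_top[OF assms(1) top])
  have "ennreal (suminf f) = ennreal c"
    using suminf_ennreal[OF assms(1) top] assms(3) by simp
  then have "suminf f = c"
    using suminf_nonneg[OF summ assms(1)] assms(2) by simp
  then show ?thesis using summ by (simp add: sums_iff)
qed

lemma log_product_sums:
  fixes x :: real
  assumes "0 \<le> x" "x < 1"
  shows "(\<lambda>k. real k * - ln (1 - x ^ k)) sums (\<Sum>N. sigma_weight N * x ^ N)"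
proof -
  have pos: "0 \<le> real k * - ln (1 - x ^ k)" for k
  proof (cases "k = 0")
    case False
    then have "x ^ k < 1" "0 \<le> x ^ k" using assms by (auto simp: power_less_one_iff)
    then show ?thesis by (intro mult_nonneg_nonneg) auto
  qed simp
  have w: "0 \<le> sigma_weight N * x ^ N" for N
    using assms sigma_weight_nonneg by simp
  have "(\<Sum>N. ennreal (sigma_weight N * x ^ N)) = ennreal (\<Sum>N. sigma_weight N * x ^ N)"
    using summable_sigma_weight[OF assms] w by (intro suminf_ennreal ennreal_suminf_neq_top)
  then show ?thesis
    using pos suminf_nonneg[OF summable_sigma_weight[OF assms] w]
    by (intro sums_of_suminf_ennreal) (simp_all only: sum_log_eq_sum_sigma_weight[OF assms])
qed

definition box_product :: "real \<Rightarrow> nat \<Rightarrow> real" where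
  "box_product x M = (\<Prod>i<M. \<Prod>j<M. 1 / (1 - x ^ (i + j + 1)))"

lemma sum_antidiagonals:
  "(\<Sum>(i, j) \<in> {(i, j). i + j < K}. f (i + j + 1)) = (\<Sum>k<Suc K. real k * f k)" for f :: "nat \<Rightarrow> real"
proof -
  have "(\<Sum>(i, j) \<in> {(i, j). i + j < K}. f (i + j + 1)) = (\<Sum>k<K. \<Sum>i\<le>k. f (i + (k - i) + 1))"
    by (rule sum.triangle_reindex)
  also have "\<dots> = (\<Sum>k<K. real (Suc k) * f (Suc k))" by simp
  finally show ?thesis by (simp add: sum.lessThan_Suc_shift del: sum.lessThan_Suc)
qed

text \<open>
  On a logarithmic scale the product over the square \<open>i, j < M\<close> is squeezed between the sums over the
  triangles \<open>i + j < M\<close> and \<open>i + j < 2 * M\<close>, where the factor \<open>1 - x ^ k\<close> occurs \<open>k\<close> times for each \<open>k\<close>.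
\<close>

lemma box_product_tendsto:
  fixes x :: real
  assumes "0 \<le> x" "x < 1"
  shows "box_product x \<longlonglongrightarrow> exp (\<Sum>N. sigma_weight N * x ^ N)"
proof -
  let ?f = "\<lambda>k. - ln (1 - x ^ k)"
  let ?S = "\<lambda>K. \<Sum>k<K. real k * ?f k"
  let ?L = "\<Sum>N. sigma_weight N * x ^ N"
  have pow: "0 \<le> x ^ k" "x ^ k < 1" if "k > 0" for k
    using assms that by (auto simp: power_less_one_iff)
  have f0: "0 \<le> ?f k" if "k > 0" for k
    using pow[OF that] by simp
  have lnP: "ln (box_product x M) = (\<Sum>(i, j) \<in> {..<M} \<times> {..<M}. ?f (i + j + 1))" for M
  proof -
    have "ln (box_product x M) = (\<Sum>i<M. \<Sum>j<M. ln (1 / (1 - x ^ (i + j + 1))))"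
    proof -
      have p: "0 < 1 / (1 - x ^ (i + j + 1))" for i j using pow[of "i + j + 1"] by simp
      have ne: "1 / (1 - x ^ (i + j + 1)) \<noteq> 0" for i j
        by (rule less_imp_neq[OF p, symmetric])
      have pne: "(\<Prod>j<M. 1 / (1 - x ^ (i + j + 1))) \<noteq> 0" for i
        by (rule less_imp_neq[OF prod_pos[OF p], symmetric])
      have "ln (box_product x M) = (\<Sum>i<M. ln (\<Prod>j<M. 1 / (1 - x ^ (i + j + 1))))"
        unfolding box_product_def by (rule ln_prod[OF finite_lessThan pne])
      also have "\<dots> = (\<Sum>i<M. \<Sum>j<M. ln (1 / (1 - x ^ (i + j + 1))))"
        by (rule sum.cong[OF refl ln_prod[OF finite_lessThan ne]])
      finally show ?thesis .
    qed
    also have "\<dots> = (\<Sum>i<M. \<Sum>j<M. ?f (i + j + 1))"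
      using pow[of "_ + _ + 1"] by (intro sum.cong refl) (simp add: ln_div)
    finally show ?thesis by (simp add: sum.cartesian_product)
  qed
  have S: "?S \<longlonglongrightarrow> ?L" using log_product_sums[OF assms] by (simp only: sums_def)
  have fin: "finite {(i, j). i + j < (K :: nat)}" for K
    by (rule finite_subset[of _ "{..<K} \<times> {..<K}"]) auto
  have "(\<lambda>M. ln (box_product x M)) \<longlonglongrightarrow> ?L"
  proof (rule tendsto_sandwich)
    show "\<forall>\<^sub>F M in sequentially. ?S (Suc M) \<le> ln (box_product x M)"
      unfolding sum_antidiagonals[symmetric] lnP
      by (intro always_eventually allI sum_mono2) (use f0[of "_ + _ + 1"] in auto)
    show "\<forall>\<^sub>F M in sequentially. ln (box_product x M) \<le> ?S (Suc (2 * M))"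
      unfolding sum_antidiagonals[symmetric] lnP
      by (intro always_eventually allI sum_mono2 fin) (use f0[of "_ + _ + 1"] in auto)
    show "(\<lambda>M. ?S (Suc M)) \<longlonglongrightarrow> ?L" using S by (rule LIMSEQ_Suc)
    have "strict_mono (\<lambda>M::nat. Suc (2 * M))" by (auto simp: strict_mono_def)
    from LIMSEQ_subseq_LIMSEQ[OF S this] show "(\<lambda>M. ?S (Suc (2 * M))) \<longlonglongrightarrow> ?L"
      by (simp only: o_def)
  qed
  from tendsto_exp[OF this] have "(\<lambda>M. exp (ln (box_product x M))) \<longlonglongrightarrow> exp ?L" .
  moreover have "box_product x M > 0" for M
    unfolding box_product_def using pow[of "_ + _ + 1"] by (intro prod_pos ballI) simp
  ultimately show ?thesis by simp
qed

lemma geometric_sum_ennreal: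
  assumes "0 \<le> z" "z < 1"
  shows "geometric_sum (ennreal z) = ennreal (1 / (1 - z))"
proof -
  have "(\<Sum>m. ennreal (z ^ m)) = ennreal (1 / (1 - z))"
    using assms geometric_sums[of z] by (intro suminf_ennreal_eq) auto
  then show ?thesis
    using assms by (simp add: geometric_sum_def nn_integral_count_space_nat ennreal_power)
qed

lemma box_arrays_of_size_eq:
  assumes "n \<le> M"
  shows "{\<pi> \<in> box_arrays M. array_size \<pi> = n} = {\<pi>. plane_partition_of \<pi> n}"
proof (intro equalityI subsetI)
  fix \<pi> assume "\<pi> \<in> {\<pi> \<in> box_arrays M. array_size \<pi> = n}"
  moreover from this have "{(i, j). \<pi> i j \<noteq> 0} \<subseteq> {..<M} \<times> {..<M}"
    by (clarsimp simp: box_arrays_def) (metis not_le neq0_conv)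
  then have "finite {(i, j). \<pi> i j \<noteq> 0}"
    by (rule finite_subset) simp
  ultimately show "\<pi> \<in> {\<pi>. plane_partition_of \<pi> n}"
    by (auto simp: box_arrays_def array_size_def plane_partition_of_def)
next
  fix \<pi> assume "\<pi> \<in> {\<pi>. plane_partition_of \<pi> n}"
  then show "\<pi> \<in> {\<pi> \<in> box_arrays M. array_size \<pi> = n}"
    using plane_partition_of_bounds(1,2)[of \<pi> n] assms
    by (fastforce simp: box_arrays_def array_size_def plane_partition_of_def)
qed

lemma box_arrays_of_size_subset: "{\<pi> \<in> box_arrays M. array_size \<pi> = n} \<subseteq> {\<pi>. plane_partition_of \<pi> n}"
proof -
  have "box_arrays M \<subseteq> box_arrays (max M n)" by (auto simp: box_arrays_def)
  then show ?thesis using box_arrays_of_size_eq[of n "max M n"] by auto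
qed

lemma box_product_expansion:
  fixes x :: real
  assumes "0 \<le> x" "x < 1"
  shows "(\<Sum>n. ennreal (real (card {\<pi> \<in> box_arrays M. array_size \<pi> = n}) * x ^ n)) = ennreal (box_product x M)"
proof -
  let ?B = "\<lambda>n. {\<pi> \<in> box_arrays M. array_size \<pi> = n}"
  have fin: "finite (?B n)" for n
    by (rule finite_subset[OF box_arrays_of_size_subset finite_plane_partitions_of])
  have "ennreal (box_product x M) = (\<Prod>i<M. \<Prod>j<M. geometric_sum (ennreal x ^ (i + j + 1)))"
  proof -
    have "geometric_sum (ennreal x ^ (i + j + 1)) = ennreal (1 / (1 - x ^ (i + j + 1)))" for i j
      using assms by (subst ennreal_power, simp, intro geometric_sum_ennreal) (auto simp: power_less_one_iff simp del: power_Suc)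
    moreover have "0 \<le> 1 / (1 - x ^ (i + j + 1))" for i j
      using assms power_le_one[of x "i + j + 1"] by simp
    ultimately show ?thesis
      unfolding box_product_def by (simp add: prod_ennreal prod_nonneg)
  qed
  also have "\<dots> = (\<integral>\<^sup>+ \<pi>. ennreal x ^ array_size \<pi> \<partial>count_space (box_arrays M))"
    by (rule MacMahon_box[symmetric])
  also have "\<dots> = (\<integral>\<^sup>+ \<pi>. (\<integral>\<^sup>+ n. ennreal x ^ n * indicator {n. n = array_size \<pi> \<and> \<pi> \<in> box_arrays M} n \<partial>count_space UNIV) \<partial>count_space UNIV)"
    by (subst nn_integral_count_space_indicator, simp, subst nn_integral_count_space_point)
       (auto intro!: nn_integral_cong split: split_indicator)
  also have "\<dots> = (\<integral>\<^sup>+ n. (\<integral>\<^sup>+ \<pi>. ennreal x ^ n * indicator (?B n) \<pi> \<partial>count_space UNIV) \<partial>count_space UNIV)"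
    by (subst nn_integral_count_space_swap) (auto intro!: nn_integral_cong split: split_indicator)
  also have "\<dots> = (\<integral>\<^sup>+ n. ennreal (real (card (?B n)) * x ^ n) \<partial>count_space UNIV)"
    using fin assms by (simp add: nn_integral_cmult emeasure_count_space ennreal_mult ennreal_power mult.commute ennreal_of_nat_eq_real_of_nat)
  finally show ?thesis by (simp add: nn_integral_count_space_nat)
qed

text \<open>
  Every partial sum of the series is a partial sum of a large enough box series, and every box
  series is dominated by the full one. Both bounds meet in the limit of the box products.
\<close>

theorem MacMahon_real:
  fixes x :: real
  assumes "0 \<le> x" "x < 1"
  shows "(\<lambda>n. real (PL n) * x ^ n) sums exp (\<Sum>N. sigma_weight N * x ^ N)"
proof -
  let ?L = "exp (\<Sum>N. sigma_weight N * x ^ N)"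
  let ?b = "\<lambda>M n. real (card {\<pi> \<in> box_arrays M. array_size \<pi> = n}) * x ^ n"
  let ?a = "\<lambda>n. real (PL n) * x ^ n"
  have b0: "0 \<le> ?b M n" for M n using assms by simp
  have a0: "0 \<le> ?a n" for n using assms by simp
  have ba: "?b M n \<le> ?a n" for M n
    using assms card_mono[OF finite_plane_partitions_of box_arrays_of_size_subset, of M n]
    by (intro mult_right_mono) (auto simp: PL_def)
  have eq: "?b M n = ?a n" if "n \<le> M" for M n
    using box_arrays_of_size_eq[OF that] by (simp add: PL_def)
  have pos: "0 \<le> box_product x M" for M
    unfolding box_product_def using assms power_le_one[of x "_ + _ + 1"] by (intro prod_nonneg ballI) simp
  have b: "?b M sums box_product x M" for M
    by (rule sums_of_suminf_ennreal[OF b0 pos box_product_expansion[OF assms]])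
  have le: "(\<Sum>n<K. ?a n) \<le> ?L" for K
  proof (rule tendsto_lowerbound[OF box_product_tendsto[OF assms]])
    show "\<forall>\<^sub>F M in sequentially. (\<Sum>n<K. ?a n) \<le> box_product x M"
      using eventually_ge_at_top[of K]
    proof eventually_elim
      case (elim M)
      have "(\<Sum>n<K. ?a n) = (\<Sum>n<K. ?b M n)" using elim by (intro sum.cong refl eq[symmetric]) auto
      also have "\<dots> \<le> box_product x M"
        using sum_le_suminf[OF sums_summable[OF b] finite_lessThan b0, of M K] sums_unique[OF b[of M]] by simp
      finally show ?case .
    qed
  qed simp
  have "summable ?a"
    by (rule summableI_nonneg_bounded[OF a0 le])
  moreover have "suminf ?a \<le> ?L"
    by (rule suminf_le_const[OF calculation le])
  moreover have "?L \<le> suminf ?a"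
  proof (rule tendsto_upperbound[OF box_product_tendsto[OF assms]])
    have "box_product x M \<le> suminf ?a" for M
      using suminf_le[OF ba sums_summable[OF b[of M]] \<open>summable ?a\<close>] sums_unique[OF b[of M]] by simp
    then show "\<forall>\<^sub>F M in sequentially. box_product x M \<le> suminf ?a" by simp
  qed simp
  ultimately show ?thesis by (metis antisym summable_sums)
qed

text \<open>
  Both sides are holomorphic in the unit disc and agree on the interval \<open>(0, 1)\<close>.
\<close>

theorem MacMahon_complex:
  fixes z :: complex
  assumes "norm z < 1"
  shows "(\<lambda>n. of_nat (PL n) * z ^ n) sums exp (\<Sum>N. of_real (sigma_weight N) * z ^ N)"
proof -
  let ?F = "\<lambda>z. \<Sum>n. of_nat (PL n) * z ^ n" and ?W = "\<lambda>z. \<Sum>N. of_real (sigma_weight N) * z ^ N"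
  have sF: "(\<lambda>n. of_nat (PL n) * z ^ n) sums ?F z" if "z \<in> ball 0 1" for z :: complex
  proof -
    have "summable (\<lambda>n. norm (of_nat (PL n) * z ^ n))"
      using MacMahon_real[of "norm z"] that by (simp add: norm_mult norm_power sums_iff)
    then show ?thesis by (rule summable_sums[OF summable_norm_cancel])
  qed
  have sW: "(\<lambda>N. of_real (sigma_weight N) * z ^ N) sums ?W z" if "z \<in> ball 0 1" for z :: complex
  proof -
    have "summable (\<lambda>N. norm (of_real (sigma_weight N) * z ^ N))"
    proof -
      have "norm (of_real (sigma_weight N) * z ^ N) = sigma_weight N * norm z ^ N" for N
        by (simp add: norm_mult norm_power abs_of_nonneg[OF sigma_weight_nonneg])
      then show ?thesis using summable_sigma_weight[of "norm z"] that by (simp only:) simp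
    qed
    then show ?thesis by (rule summable_sums[OF summable_norm_cancel])
  qed
  have hF: "?F holomorphic_on ball 0 1"
    using sF by (intro power_series_holomorphic[where a = "\<lambda>n. of_nat (PL n)"]) auto
  have hW: "?W holomorphic_on ball 0 1"
    using sW by (intro power_series_holomorphic[where a = "\<lambda>n. of_real (sigma_weight n)"]) auto
  have "?F z - exp (?W z) = 0"
  proof (rule analytic_continuation[where f = "\<lambda>z. ?F z - exp (?W z)" and S = "ball 0 1"
        and U = "complex_of_real ` {0<..<1}" and \<xi> = 0])
    show "(\<lambda>z. ?F z - exp (?W z)) holomorphic_on ball 0 1"
      by (intro holomorphic_intros hF hW)
    show "complex_of_real ` {0<..<1} \<subseteq> ball 0 1" by auto
    show "0 islimpt complex_of_real ` {0<..<1}"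
      unfolding islimpt_approachable
    proof (intro allI impI)
      fix e :: real assume "e > 0"
      then show "\<exists>x'\<in>complex_of_real ` {0<..<1}. x' \<noteq> 0 \<and> dist x' 0 < e"
        by (intro bexI[of _ "complex_of_real (min e 1 / 2)"] imageI) auto
    qed
    fix u assume "u \<in> complex_of_real ` {0<..<1}"
    then obtain x where x: "u = of_real x" "0 < x" "x < 1" by auto
    have "(\<lambda>n. complex_of_real (real (PL n) * x ^ n)) sums of_real (exp (\<Sum>N. sigma_weight N * x ^ N))"
      by (subst sums_of_real_iff) (use MacMahon_real x in auto)
    then have "(\<lambda>n. of_nat (PL n) * u ^ n) sums of_real (exp (\<Sum>N. sigma_weight N * x ^ N))"
      by (simp add: x)
    moreover have "complex_of_real (\<Sum>N. sigma_weight N * x ^ N) = ?W u"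
      using suminf_of_real[OF summable_sigma_weight[of x]] x by simp
    ultimately show "?F u - exp (?W u) = 0"
      by (simp add: sums_iff exp_of_real[symmetric])
  qed (use assms in auto)
  then show ?thesis using sF[of z] assms by simp
qed

section \<open>Gaussian integrals and Hermite polynomials\<close>

text \<open>
  Exponential decay dominates \<open>inverse (1 + u\<^sup>2)\<close>, whose integrability over the line is known; the
  proof compares with \<open>(1 + v / m) ^ m \<le> exp v\<close> for the exponent \<open>m = d + 2\<close>.
\<close>

lemma power_times_exp_le:
  fixes a c :: real
  assumes "0 \<le> a" "0 < c"
  shows "\<exists>K. \<forall>u::real. (\<bar>u\<bar> + a) ^ d * exp (- \<bar>u\<bar> / c) \<le> K * inverse (1 + u\<^sup>2)"
proof -
  define m where "m = d + 2"
  \<comment> \<open>The maximum with \<open>1\<close> lets \<open>b\<close> also absorb the additive constant \<open>a + 1\<close>.\<close>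
  define b where "b = max 1 (c * real m)"
  have m: "m > 0" and b: "b \<ge> 1" "b > 0" "c * real m \<le> b" by (simp_all add: m_def b_def)
  have "(\<bar>u\<bar> + a) ^ d * exp (- \<bar>u\<bar> / c) \<le> (b * (a + 1)) ^ m * inverse (1 + u\<^sup>2)" for u :: real
  proof -
    have "(1 + \<bar>u\<bar> / b) ^ m \<le> (1 + (\<bar>u\<bar> / c) / real m) ^ m"
    proof (intro power_mono add_left_mono)
      have "\<bar>u\<bar> / b \<le> \<bar>u\<bar> / (c * real m)"
        using b m assms by (intro divide_left_mono) auto
      then show "\<bar>u\<bar> / b \<le> (\<bar>u\<bar> / c) / real m" by simp
    qed (use b in simp)
    also have "\<dots> \<le> exp (\<bar>u\<bar> / c)"
    proof (rule exp_ge_one_plus_x_over_n_power_n)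
      have "0 \<le> \<bar>u\<bar> / c" using assms by simp
      then show "- real m \<le> \<bar>u\<bar> / c" by linarith
    qed (use m in simp)
    finally have e: "(1 + \<bar>u\<bar> / b) ^ m \<le> exp (\<bar>u\<bar> / c)" .
    have "(\<bar>u\<bar> + a) ^ d * (1 + u\<^sup>2) \<le> (\<bar>u\<bar> + a + 1) ^ d * (\<bar>u\<bar> + a + 1)\<^sup>2"
      using assms by (intro mult_mono power_mono) (auto simp: power2_eq_square algebra_simps)
    also have "\<dots> = (\<bar>u\<bar> + a + 1) ^ m" by (simp only: m_def power_add)
    also have "\<dots> \<le> ((b * (a + 1)) * (1 + \<bar>u\<bar> / b)) ^ m"
    proof (rule power_mono)
      have "(b * (a + 1)) * (1 + \<bar>u\<bar> / b) = b * (a + 1) + (a + 1) * \<bar>u\<bar>"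
        using b(2) by (simp add: field_simps)
      moreover have "1 * (a + 1) + 1 * \<bar>u\<bar> \<le> b * (a + 1) + (a + 1) * \<bar>u\<bar>"
        using b assms by (intro add_mono mult_right_mono) simp_all
      then have "\<bar>u\<bar> + a + 1 \<le> b * (a + 1) + (a + 1) * \<bar>u\<bar>"
        by (simp only: mult_1_left add_ac)
      ultimately show "\<bar>u\<bar> + a + 1 \<le> (b * (a + 1)) * (1 + \<bar>u\<bar> / b)" by simp
    qed (use assms in simp)
    also have "\<dots> = (b * (a + 1)) ^ m * (1 + \<bar>u\<bar> / b) ^ m" by (rule power_mult_distrib)
    also have "\<dots> \<le> (b * (a + 1)) ^ m * exp (\<bar>u\<bar> / c)"
      by (rule mult_left_mono[OF e]) (use b assms in simp)
    finally have main: "(\<bar>u\<bar> + a) ^ d * (1 + u\<^sup>2) \<le> (b * (a + 1)) ^ m * exp (\<bar>u\<bar> / c)" .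
    have pos: "1 + u\<^sup>2 > 0" by (simp add: add_pos_nonneg)
    have "(\<bar>u\<bar> + a) ^ d * (1 + u\<^sup>2) * (exp (- \<bar>u\<bar> / c) * inverse (1 + u\<^sup>2))
        \<le> (b * (a + 1)) ^ m * exp (\<bar>u\<bar> / c) * (exp (- \<bar>u\<bar> / c) * inverse (1 + u\<^sup>2))"
      by (rule mult_right_mono[OF main]) (use pos in simp)
    moreover have "(\<bar>u\<bar> + a) ^ d * (1 + u\<^sup>2) * (exp (- \<bar>u\<bar> / c) * inverse (1 + u\<^sup>2)) =
        (\<bar>u\<bar> + a) ^ d * exp (- \<bar>u\<bar> / c) * ((1 + u\<^sup>2) * inverse (1 + u\<^sup>2))"
      by (simp only: mult_ac)
    moreover have "(b * (a + 1)) ^ m * exp (\<bar>u\<bar> / c) * (exp (- \<bar>u\<bar> / c) * inverse (1 + u\<^sup>2)) =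
        (b * (a + 1)) ^ m * inverse (1 + u\<^sup>2) * (exp (\<bar>u\<bar> / c) * exp (- (\<bar>u\<bar> / c)))"
      by (simp only: mult_ac minus_divide_left)
    moreover have "(1 + u\<^sup>2) * inverse (1 + u\<^sup>2) = 1" using pos by (intro right_inverse) simp
    moreover have "exp (\<bar>u\<bar> / c) * exp (- (\<bar>u\<bar> / c)) = 1" by (simp flip: exp_add)
    ultimately show ?thesis by (simp only: mult_1_right)
  qed
  then show ?thesis by blast
qed

lemma integrable_inverse_one_plus_square: "integrable lborel (\<lambda>x::real. inverse (1 + x\<^sup>2))"
  using integrable_inverse_1_plus_square by (simp add: set_integrable_def)

lemma integrable_power_times_exp:
  fixes a c :: real
  assumes "0 \<le> a" "0 < c"
  shows "integrable lborel (\<lambda>u. (\<bar>u\<bar> + a) ^ d * exp (- \<bar>u\<bar> / c))"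
proof -
  obtain K where K: "\<And>u::real. (\<bar>u\<bar> + a) ^ d * exp (- \<bar>u\<bar> / c) \<le> K * inverse (1 + u\<^sup>2)"
    using power_times_exp_le[OF assms] by blast
  show ?thesis
  proof (rule Bochner_Integration.integrable_bound)
    show "integrable lborel (\<lambda>u. K * inverse (1 + u\<^sup>2))"
      using integrable_inverse_one_plus_square by (rule integrable_mult_right)
    show "AE u in lborel. norm ((\<bar>u\<bar> + a) ^ d * exp (- \<bar>u\<bar> / c)) \<le> norm (K * inverse (1 + u\<^sup>2))"
    proof (rule AE_I2)
      fix u :: real
      have "norm ((\<bar>u\<bar> + a) ^ d * exp (- \<bar>u\<bar> / c)) = (\<bar>u\<bar> + a) ^ d * exp (- \<bar>u\<bar> / c)"
        using assms by simp
      also have "\<dots> \<le> norm (K * inverse (1 + u\<^sup>2))"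
        using K[of u] unfolding real_norm_def by (rule order_trans[OF _ abs_ge_self])
      finally show "norm ((\<bar>u\<bar> + a) ^ d * exp (- \<bar>u\<bar> / c)) \<le> norm (K * inverse (1 + u\<^sup>2))" .
    qed
  qed measurable
qed

definition gauss_integrand :: "nat \<Rightarrow> real \<Rightarrow> real \<Rightarrow> complex" where
  "gauss_integrand d y u = (of_real y + \<i> * of_real u) ^ d * of_real (exp (- u\<^sup>2 / 2))"

lemma norm_gauss_integrand_le:
  "norm (gauss_integrand d y u) \<le> exp 1 * ((\<bar>u\<bar> + \<bar>y\<bar>) ^ d * exp (- \<bar>u\<bar> / 1))"
proof -
  have "norm (of_real y + \<i> * of_real u :: complex) \<le> \<bar>u\<bar> + \<bar>y\<bar>"
    by (rule order_trans[OF norm_triangle_ineq]) (simp add: norm_mult)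
  then have "norm (of_real y + \<i> * of_real u :: complex) ^ d \<le> (\<bar>u\<bar> + \<bar>y\<bar>) ^ d"
    by (rule power_mono) simp
  moreover have "- u\<^sup>2 / 2 \<le> 1 - \<bar>u\<bar>"
    using zero_le_power2[of "\<bar>u\<bar> - 1"] by (simp add: power2_eq_square algebra_simps)
  then have "exp (- u\<^sup>2 / 2) \<le> exp 1 * exp (- \<bar>u\<bar>)"
    by (simp flip: exp_add)
  ultimately show ?thesis
    unfolding gauss_integrand_def norm_mult norm_power
    using mult_mono[of "norm (of_real y + \<i> * of_real u :: complex) ^ d" "(\<bar>u\<bar> + \<bar>y\<bar>) ^ d" "exp (- u\<^sup>2 / 2)" "exp 1 * exp (- \<bar>u\<bar>)"]
    by (simp add: mult_ac)
qed

lemma borel_measurable_gauss_integrand [measurable]: "gauss_integrand d y \<in> borel_measurable borel"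
  unfolding gauss_integrand_def by measurable

lemma integrable_gauss_integrand: "integrable lborel (gauss_integrand d y)"
proof (rule Bochner_Integration.integrable_bound)
  show "integrable lborel (\<lambda>u. exp 1 * ((\<bar>u\<bar> + \<bar>y\<bar>) ^ d * exp (- \<bar>u\<bar> / 1)))"
    by (intro integrable_mult_right integrable_power_times_exp) auto
  show "AE u in lborel. norm (gauss_integrand d y u) \<le> norm (exp 1 * ((\<bar>u\<bar> + \<bar>y\<bar>) ^ d * exp (- \<bar>u\<bar> / 1)))"
    by (intro AE_I2 order_trans[OF norm_gauss_integrand_le]) simp
qed simp

lemma gauss_integrand_tendsto_0:
  "(gauss_integrand d y \<longlongrightarrow> 0) at_top" "(gauss_integrand d y \<longlongrightarrow> 0) at_bot"
proof -
  obtain K where K: "\<And>u::real. (\<bar>u\<bar> + \<bar>y\<bar>) ^ d * exp (- \<bar>u\<bar> / 1) \<le> K * inverse (1 + u\<^sup>2)"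
    using power_times_exp_le[of "\<bar>y\<bar>" 1 d] by auto
  have "norm (gauss_integrand d y u) \<le> exp 1 * (K * inverse (1 + u\<^sup>2))" for u
    by (rule order_trans[OF norm_gauss_integrand_le mult_left_mono[OF K]]) simp
  then have *: "\<forall>\<^sub>F u in F. norm (gauss_integrand d y u) \<le> exp 1 * (K * inverse (1 + u\<^sup>2))" for F
    by simp
  have "((\<lambda>u::real. exp 1 * (K * inverse (1 + u\<^sup>2))) \<longlongrightarrow> 0) at_top" by real_asymp
  with * show "(gauss_integrand d y \<longlongrightarrow> 0) at_top" by (rule Lim_null_comparison)
  have "((\<lambda>u::real. exp 1 * (K * inverse (1 + u\<^sup>2))) \<longlongrightarrow> 0) at_bot" by real_asymp
  with * show "(gauss_integrand d y \<longlongrightarrow> 0) at_bot" by (rule Lim_null_comparison)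
qed

definition gauss_moment :: "nat \<Rightarrow> real \<Rightarrow> complex" where
  "gauss_moment d y = (LINT u|lborel. gauss_integrand d y u)"

lemma set_integrable_whole_line:
  fixes f :: "real \<Rightarrow> complex"
  shows "integrable lborel f \<Longrightarrow> set_integrable lborel (einterval (-\<infinity>) \<infinity>) f"
  by (simp add: set_integrable_def)

lemma interval_integral_whole_line:
  fixes f :: "real \<Rightarrow> complex"
  shows "(LBINT u=-\<infinity>..\<infinity>. f u) = (LINT u|lborel. f u)"
  by (simp add: interval_lebesgue_integral_def set_lebesgue_integral_def)

text \<open>
  Integration by parts: with \<open>w = y + \<i> * u\<close>, the derivative of \<open>w ^ d * exp (- u\<^sup>2 / 2)\<close> is \<open>\<i>\<close> times
  \<open>(d * w ^ (d - 1) + w ^ Suc d - y * w ^ d) * exp (- u\<^sup>2 / 2)\<close>, and its integral over the line vanishes.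
  For \<open>d = 0\<close> the truncated index \<open>d - 1\<close> is harmless since its coefficient is \<open>0\<close>.
\<close>

lemma gauss_moment_Suc:
  "gauss_moment (Suc d) y = of_real y * gauss_moment d y - of_nat d * gauss_moment (d - 1) y"
proof -
  let ?f = "\<lambda>u. \<i> * (of_nat d * gauss_integrand (d - 1) y u + gauss_integrand (Suc d) y u - of_real y * gauss_integrand d y u)"
  have deriv: "(gauss_integrand d y has_vector_derivative ?f u) (at u)" for u
  proof -
    have "((\<lambda>u. (of_real y + \<i> * of_real u) ^ d * of_real (exp (- u\<^sup>2 / 2))) has_vector_derivative
        ((of_real y + \<i> * of_real u) ^ d * of_real (exp (- u\<^sup>2 / 2) * (- u)) +
          (of_nat d * \<i> * (of_real y + \<i> * of_real u) ^ (d - 1)) * of_real (exp (- u\<^sup>2 / 2)))) (at u)"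
    proof (rule has_vector_derivative_mult)
      have "((\<lambda>w. (of_real y + \<i> * w) ^ d) has_field_derivative (of_nat d * \<i> * (of_real y + \<i> * of_real u) ^ (d - 1))) (at (of_real u))"
        by (auto intro!: derivative_eq_intros)
      from has_vector_derivative_real_field[OF this]
      show "((\<lambda>u. (of_real y + \<i> * of_real u) ^ d) has_vector_derivative (of_nat d * \<i> * (of_real y + \<i> * of_real u) ^ (d - 1))) (at u)" .
      have "((\<lambda>u. exp (- u\<^sup>2 / 2)) has_real_derivative exp (- u\<^sup>2 / 2) * (- u)) (at u)"
        by (auto intro!: derivative_eq_intros)
      then show "((\<lambda>u. complex_of_real (exp (- u\<^sup>2 / 2))) has_vector_derivative of_real (exp (- u\<^sup>2 / 2) * (- u))) (at u)"
        by (intro has_vector_derivative_of_real) (simp add: has_real_derivative_iff_has_vector_derivative)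
    qed
    also have "((of_real y + \<i> * of_real u) ^ d * of_real (exp (- u\<^sup>2 / 2) * (- u)) +
          (of_nat d * \<i> * (of_real y + \<i> * of_real u) ^ (d - 1)) * of_real (exp (- u\<^sup>2 / 2))) = ?f u"
      by (simp add: gauss_integrand_def algebra_simps)
    finally show ?thesis by (simp add: gauss_integrand_def[abs_def])
  qed
  have int: "integrable lborel ?f"
    by (intro integrable_mult_right Bochner_Integration.integrable_add Bochner_Integration.integrable_diff
        integrable_gauss_integrand)
  have "(LBINT u=-\<infinity>..\<infinity>. ?f u) = 0 - 0"
  proof (rule interval_integral_FTC_integrable[where F = "gauss_integrand d y"])
    show "set_integrable lborel (einterval (-\<infinity>) \<infinity>) ?f"
      using int by (rule set_integrable_whole_line)
    show "isCont ?f u" for u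
      unfolding gauss_integrand_def by (intro continuous_intros) auto
    show "((gauss_integrand d y \<circ> real_of_ereal) \<longlongrightarrow> 0) (at_right (-\<infinity>))"
      "((gauss_integrand d y \<circ> real_of_ereal) \<longlongrightarrow> 0) (at_left \<infinity>)"
      using gauss_integrand_tendsto_0 by (simp_all only: ereal_tendsto_simps)
    show "(gauss_integrand d y has_vector_derivative ?f u) (at u)" for u
      by (rule deriv)
  qed simp
  then have "(LINT u|lborel. ?f u) = 0"
    by (simp only: interval_integral_whole_line diff_self)
  then have "\<i> * (of_nat d * gauss_moment (d - 1) y + gauss_moment (Suc d) y - of_real y * gauss_moment d y) = 0"
    by (simp add: gauss_moment_def integrable_gauss_integrand)
  then have "of_nat d * gauss_moment (d - 1) y + gauss_moment (Suc d) y - of_real y * gauss_moment d y = 0"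
    using mult_eq_0_iff complex_i_not_zero by blast
  then show ?thesis by (simp add: algebra_simps)
qed

lemma gauss_moment_0: "gauss_moment 0 y = of_real (sqrt (2 * pi))"
proof -
  have "gauss_moment 0 y = of_real (LINT u|lborel. exp (- u\<^sup>2 / 2))"
    by (simp add: gauss_moment_def gauss_integrand_def)
  also have "(LINT u|lborel. exp (- u\<^sup>2 / 2)) = (LINT u|lborel. sqrt (2 * pi) * std_normal_density u)"
    by (simp add: normal_density_def)
  also have "\<dots> = sqrt (2 * pi)"
    using integral_std_normal_moment_even[of 0] by simp
  finally show ?thesis .
qed

text \<open>
  The probabilists' Hermite polynomials; the recurrence is that of the Gaussian integrals above.
\<close>

fun hermite :: "nat \<Rightarrow> real poly" where
  "hermite 0 = 1"
| "hermite (Suc 0) = [:0, 1:]"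
| "hermite (Suc (Suc n)) = [:0, 1:] * hermite (Suc n) - smult (real (Suc n)) (hermite n)"

lemma gauss_moment_eq_hermite:
  "gauss_moment d y = of_real (sqrt (2 * pi) * poly (hermite d) y)"
  by (induction d rule: hermite.induct)
    (simp_all add: gauss_moment_0 gauss_moment_Suc[of 0] gauss_moment_Suc[of "Suc _"] algebra_simps del: of_nat_Suc)

lemma pderiv_hermite: "pderiv (hermite (Suc n)) = smult (real (Suc n)) (hermite n)"
proof (induction n rule: hermite.induct)
  case (3 n)
  have rec: "hermite (Suc (Suc (Suc n))) = [:0, 1:] * hermite (Suc (Suc n)) - smult (real (Suc (Suc n))) (hermite (Suc n))"
    by (rule hermite.simps(3))
  have "pderiv (hermite (Suc (Suc (Suc n)))) = hermite (Suc (Suc n)) + smult (real (Suc (Suc n)))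
      ([:0, 1:] * hermite (Suc n) - smult (real (Suc n)) (hermite n))"
  proof -
    have X: "pderiv [:0, 1 :: real:] = 1" by (simp add: pderiv_pCons)
    show ?thesis
      unfolding rec pderiv_diff pderiv_mult pderiv_smult 3 X
      by (simp only: mult_1_right mult_smult_right smult_diff_right smult_smult algebra_simps)
  qed
  also have "\<dots> = hermite (Suc (Suc n)) + smult (real (Suc (Suc n))) (hermite (Suc (Suc n)))"
    by (simp only: hermite.simps(3))
  also have "\<dots> = smult (real (Suc (Suc (Suc n)))) (hermite (Suc (Suc n)))"
    by (simp only: of_nat_Suc[of "Suc (Suc n)"] smult_add_left smult_1_left add.commute)
  finally show ?case .
qed (simp_all add: pderiv_pCons pderiv_diff pderiv_mult pderiv_smult algebra_simps)

lemma hermite_Suc: "hermite (Suc n) = [:0, 1:] * hermite n - pderiv (hermite n)"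
  by (cases n) (simp_all add: pderiv_hermite)

lemma degree_lead_coeff_hermite: "degree (hermite n) = n \<and> lead_coeff (hermite n) = 1"
proof (induction n rule: hermite.induct)
  case (3 n)
  have "degree ([:0, 1:] * hermite (Suc n)) = Suc (Suc n)"
    using 3 by (subst degree_mult_eq) auto
  moreover have "degree (smult (real (Suc n)) (hermite n)) < Suc (Suc n)"
    using 3 by (auto intro: le_less_trans[OF degree_smult_le])
  moreover have "lead_coeff ([:0, 1:] * hermite (Suc n)) = 1"
    using 3 by (subst lead_coeff_mult) auto
  ultimately have "degree (hermite (Suc (Suc n))) = Suc (Suc n)" "coeff (hermite (Suc (Suc n))) (Suc (Suc n)) = 1"
    using degree_add_eq_left[of "- smult (real (Suc n)) (hermite n)" "[:0, 1:] * hermite (Suc n)"]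
    by (simp_all only: hermite.simps(3) diff_conv_add_uminus degree_minus coeff_add coeff_minus coeff_eq_0 add_0_right minus_zero)
  then show ?case by (simp only:)
qed simp_all

lemma poly_hermite_minus: "poly (hermite n) (- y) = (- 1) ^ n * poly (hermite n) y"
  by (induction n rule: hermite.induct) (simp_all add: algebra_simps)

text \<open>
  Since \<open>(He\<^sub>d(y) * exp (- y\<^sup>2 / 2))' = - He\<^sub>d\<^sub>+\<^sub>1(y) * exp (- y\<^sup>2 / 2)\<close>, the mean value theorem places between
  two points where \<open>He\<^sub>d\<close> has opposite signs a point where the sign of \<open>He\<^sub>d\<^sub>+\<^sub>1\<close> is opposite to that of \<open>He\<^sub>d\<close> at the right one.
  This gives \<open>d\<close> alternating points for \<open>He\<^sub>d\<^sub>+\<^sub>1\<close>; two more come from its behaviour at infinity.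
\<close>

lemma hermite_alternates:
  "\<exists>x. (\<forall>i<d. x i < x (Suc i)) \<and> (\<forall>i\<le>d. 0 < (- 1) ^ (d - i) * poly (hermite d) (x i))"
proof (induction d)
  case 0
  show ?case by auto
next
  case (Suc d)
  then obtain x where x: "\<And>i. i < d \<Longrightarrow> x i < x (Suc i)"
    "\<And>i. i \<le> d \<Longrightarrow> 0 < (- 1) ^ (d - i) * poly (hermite d) (x i)" by blast
  let ?g = "\<lambda>y. poly (hermite d) y * exp (- y\<^sup>2 / 2)"
  have g': "(?g has_real_derivative - poly (hermite (Suc d)) y * exp (- y\<^sup>2 / 2)) (at y)" for y
    by (auto intro!: derivative_eq_intros poly_DERIV simp: hermite_Suc algebra_simps simp del: hermite.simps)
  have "\<exists>z. x i < z \<and> z < x (Suc i) \<and> 0 < (- 1) ^ (d - i) * poly (hermite (Suc d)) z" if i: "i < d" for i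
  proof -
    obtain z where z: "x i < z" "z < x (Suc i)"
      "?g (x (Suc i)) - ?g (x i) = (x (Suc i) - x i) * (- poly (hermite (Suc d)) z * exp (- z\<^sup>2 / 2))"
      using MVT2[OF x(1)[OF i] g'] by blast
    have s: "(- 1) ^ (d - i) = - ((- 1) ^ (d - Suc i) :: real)"
      using i by (metis Suc_diff_Suc mult_minus1 power_Suc)
    have "0 < (- 1) ^ (d - Suc i) * ?g (x (Suc i))" "0 < (- 1) ^ (d - i) * ?g (x i)"
      using x(2)[of i] x(2)[of "Suc i"] i by (simp_all flip: mult.assoc)
    then have "0 < (- 1) ^ (d - Suc i) * (?g (x (Suc i)) - ?g (x i))"
      unfolding s by (simp add: algebra_simps)
    also have "\<dots> = ((x (Suc i) - x i) * exp (- z\<^sup>2 / 2)) * ((- 1) ^ (d - i) * poly (hermite (Suc d)) z)"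
      unfolding z(3) s by (simp add: algebra_simps)
    finally have "0 < (- 1) ^ (d - i) * poly (hermite (Suc d)) z"
      by (rule zero_less_mult_pos) (use x(1)[OF i] in simp)
    then show ?thesis using z by blast
  qed
  then obtain z where z: "\<And>i. i < d \<Longrightarrow> x i < z i" "\<And>i. i < d \<Longrightarrow> z i < x (Suc i)"
    "\<And>i. i < d \<Longrightarrow> 0 < (- 1) ^ (d - i) * poly (hermite (Suc d)) (z i)" by metis
  obtain B where B: "\<And>y. y \<ge> B \<Longrightarrow> poly (hermite (Suc d)) y > 0"
  proof -
    have lc: "lead_coeff (hermite (Suc d)) = 1" using degree_lead_coeff_hermite by blast
    then have "lead_coeff (hermite (Suc d)) > 0" by (simp only: zero_less_one)
    from poly_pinfty_gt_lc[OF this] obtain B where "\<And>y. y \<ge> B \<Longrightarrow> lead_coeff (hermite (Suc d)) \<le> poly (hermite (Suc d)) y" by blast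
    then have "\<And>y. y \<ge> B \<Longrightarrow> poly (hermite (Suc d)) y > 0" unfolding lc by (meson less_le_trans zero_less_one)
    then show ?thesis by (rule that)
  qed
  \<comment> \<open>Far enough to the right of all points for the leading term to decide the sign, and, by parity, also far enough to the left.\<close>
  define R where "R = max B (max (x d) (- x 0)) + 1"
  have R: "R \<ge> B" "R > x d" "- R < x 0" by (auto simp: R_def)
  let ?x = "\<lambda>i. if i = 0 then - R else if i \<le> d then z (i - 1) else R"
  have incr: "?x i < ?x (Suc i)" if "i < Suc d" for i
  proof -
    consider "i = 0" "d = 0" | "i = 0" "d > 0" | "0 < i" "i < d" | "0 < i" "i = d"
      using \<open>i < Suc d\<close> by linarith
    then show ?thesis
    proof cases
      case 3
      then show ?thesis using z(2)[of "i - 1"] z(1)[of i] by (simp add: less_trans[of _ "x i"])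
    next
      case 4
      then show ?thesis using z(2)[of "i - 1"] R by simp
    qed (use R z(1)[of 0] in simp_all)
  qed
  have sign: "0 < (- 1) ^ (Suc d - i) * poly (hermite (Suc d)) (?x i)" if "i \<le> Suc d" for i
  proof -
    consider "i = 0" | "0 < i" "i \<le> d" | "i = Suc d" using \<open>i \<le> Suc d\<close> by linarith
    then show ?thesis
    proof cases
      case 1
      then show ?thesis using B[OF R(1)]
        by (simp add: poly_hermite_minus minus_one_power_iff del: hermite.simps)
    next
      case 2
      then obtain j where "i = Suc j" by (cases i) auto
      then show ?thesis using 2 z(3)[of j] by simp
    next
      case 3
      then show ?thesis using B[OF R(1)] by simp
    qed
  qed
  show ?case
    by (intro exI[of _ ?x] conjI allI impI incr sign)
qed

section \<open>Hyperbolicity from alternating signs\<close>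

text \<open>
  The intermediate value theorem yields \<open>d\<close> distinct real roots. A nonzero polynomial of degree at most
  \<open>d\<close> has no room for any further complex root.
\<close>

lemma hyperbolic_if_alternates:
  fixes p :: "real poly"
  assumes deg: "degree p \<le> d"
    and x: "\<And>i. i < d \<Longrightarrow> x i < x (Suc i)"
    and s: "\<And>i. i \<le> d \<Longrightarrow> 0 < (- 1) ^ (d - i) * poly p (x i)"
  shows "hyperbolic p"
proof -
  have "\<exists>r. x i < r \<and> r < x (Suc i) \<and> poly p r = 0" if i: "i < d" for i
  proof -
    have "(- 1) ^ (d - i) = - ((- 1) ^ (d - Suc i) :: real)"
      using i by (metis Suc_diff_Suc mult_minus1 power_Suc)
    then have "poly p (x i) * poly p (x (Suc i)) < 0"
      using s[of i] s[of "Suc i"] i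
      by (cases "even (d - Suc i)") (auto simp: mult_less_0_iff)
    from poly_IVT[OF x[OF i] this] show ?thesis by blast
  qed
  then obtain r where r: "\<And>i. i < d \<Longrightarrow> x i < r i" "\<And>i. i < d \<Longrightarrow> r i < x (Suc i)"
    "\<And>i. i < d \<Longrightarrow> poly p (r i) = 0" by metis
  have mono: "x (Suc i) \<le> x j" if "i < j" "j \<le> d" for i j
    using that(1,2) 
  proof (induction j)
    case (Suc j)
    show ?case
    proof (cases "i = j")
      case False
      then have "x (Suc i) \<le> x j" using Suc by simp
      also have "\<dots> < x (Suc j)" using Suc x by simp
      finally show ?thesis by simp
    qed simp
  qed simp
  have less: "r i < r j" if "i < j" "j < d" for i j
    using r(2)[of i] r(1)[of j] mono[of i j] that by simp
  have inj: "inj_on r {..<d}"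
    by (rule inj_onI) (metis less less_irrefl lessThan_iff linorder_neqE_nat)
  define P where "P = map_poly complex_of_real p"
  have "p \<noteq> 0" using s[of 0] by auto
  then have P: "P \<noteq> 0" "degree P \<le> d"
    using deg using map_poly_degree_leq[of complex_of_real p] by (auto simp: P_def map_poly_eq_0_iff)
  have "poly P (of_real a) = of_real (poly p a)" for a
    unfolding P_def by (induction p) (auto simp: map_poly_pCons)
  then have sub: "of_real ` r ` {..<d} \<subseteq> {z. poly P z = 0}"
    using r(3) by auto
  have "card (complex_of_real ` r ` {..<d}) = d"
    using inj by (simp add: card_image inj_on_def)
  moreover have "card {z. poly P z = 0} \<le> d"
    using card_poly_roots_bound[OF P(1)] P(2) by simp
  ultimately have roots: "of_real ` r ` {..<d} = {z. poly P z = 0}"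
    using card_seteq[OF poly_roots_finite[OF P(1)] sub] by simp
  show ?thesis
    unfolding hyperbolic_def P_def[symmetric]
  proof (intro allI impI)
    fix z assume "poly P z = 0"
    then have "z \<in> of_real ` r ` {..<d}" unfolding roots by simp
    then show "z \<in> \<real>" by auto
  qed
qed

section \<open>Moments of the Boltzmann weights\<close>

definition power_sum :: "nat \<Rightarrow> real \<Rightarrow> real" where
  "power_sum k q = (\<Sum>n. real n ^ k * q ^ n)"

definition moment :: "nat \<Rightarrow> real \<Rightarrow> real" where
  "moment k q = (\<Sum>n. sigma_weight n * real n ^ k * q ^ n)"

lemma sums_nat_times_power:
  fixes z :: "'a :: {real_normed_field, banach}"
  assumes "norm z < 1"
  shows "(\<lambda>n. of_nat n * z ^ n) sums (z / (1 - z)\<^sup>2)"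
proof -
  have "(\<lambda>n. z * (of_nat (Suc n) * z ^ n)) sums (z * (1 / (1 - z)\<^sup>2))"
    by (rule sums_mult[OF geometric_deriv_sums[OF assms]])
  moreover have "(\<lambda>n. z * (of_nat (Suc n) * z ^ n)) = (\<lambda>n. of_nat (Suc n) * z ^ Suc n)"
    by (simp add: fun_eq_iff mult_ac)
  ultimately have "(\<lambda>n. of_nat (Suc n) * z ^ Suc n) sums (z / (1 - z)\<^sup>2)"
    by (simp only: times_divide_eq_right mult_1_right)
  then show ?thesis
    by (subst (asm) sums_Suc_iff) simp
qed

lemma power_Suc_diff_bounds:
  fixes a :: nat
  shows "real (Suc a) ^ j \<le> real (Suc a) ^ Suc j - real a ^ Suc j"
    and "real (Suc a) ^ Suc j - real a ^ Suc j \<le> real (Suc j) * real (Suc a) ^ j"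
proof -
  have "real a ^ j \<le> real (Suc a) ^ j" by (intro power_mono) auto
  then have "real a * real a ^ j \<le> real a * real (Suc a) ^ j"
    by (rule mult_left_mono) simp
  then show "real (Suc a) ^ j \<le> real (Suc a) ^ Suc j - real a ^ Suc j"
    by (simp add: algebra_simps)
  have "real (Suc a) ^ Suc j - real a ^ Suc j = (\<Sum>i<Suc j. real (Suc a) ^ i * real a ^ (j - i))"
    using power_diff_sumr2[of "real (Suc a)" "Suc j" "real a"] by (simp add: mult_ac)
  also have "\<dots> \<le> (\<Sum>i<Suc j. real (Suc a) ^ j)"
  proof (rule sum_mono)
    fix i assume "i \<in> {..<Suc j}"
    then have "real (Suc a) ^ j = real (Suc a) ^ i * real (Suc a) ^ (j - i)"
      by (simp flip: power_add)
    moreover have "real a ^ (j - i) \<le> real (Suc a) ^ (j - i)" by (intro power_mono) auto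
    ultimately show "real (Suc a) ^ i * real a ^ (j - i) \<le> real (Suc a) ^ j"
      by (simp add: mult_left_mono)
  qed
  finally show "real (Suc a) ^ Suc j - real a ^ Suc j \<le> real (Suc j) * real (Suc a) ^ j"
    by (simp only: sum_constant card_lessThan)
qed

text \<open>
  Multiplication by \<open>1 - q\<close> replaces the coefficients \<open>n ^ k\<close> by their differences
  \<open>(n + 1) ^ k - n ^ k\<close>, which lie between \<open>(n + 1) ^ (k - 1)\<close> and \<open>k * (n + 1) ^ (k - 1)\<close>.
\<close>

lemma power_sum_step:
  assumes "0 \<le> q" "q < 1"
  shows "power_sum (Suc j) q \<le> (1 - q) * power_sum (Suc (Suc j)) q"
    and "(1 - q) * power_sum (Suc (Suc j)) q \<le> real (Suc (Suc j)) * power_sum (Suc j) q"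
proof -
  have summ: "summable (\<lambda>n. real n ^ k * q ^ n)" for k
    by (rule summable_power_times_geometric[OF assms])
  have shift: "(\<lambda>n. real (Suc n) ^ Suc k * q ^ Suc n) sums power_sum (Suc k) q" for k
    using summable_sums[OF summ[of "Suc k"]] unfolding power_sum_def
    by (subst sums_Suc_iff) simp
  have "(\<lambda>n. q * (real n ^ Suc (Suc j) * q ^ n)) sums (q * power_sum (Suc (Suc j)) q)"
    unfolding power_sum_def by (intro sums_mult summable_sums summ)
  from sums_diff[OF shift[of "Suc j"] this]
  have d: "(\<lambda>n. (real (Suc n) ^ Suc (Suc j) - real n ^ Suc (Suc j)) * q ^ Suc n) sums ((1 - q) * power_sum (Suc (Suc j)) q)"
    by (simp only: left_diff_distrib right_diff_distrib power_Suc[of q] mult_ac mult_1_left mult_1_right)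
  show "power_sum (Suc j) q \<le> (1 - q) * power_sum (Suc (Suc j)) q"
    by (rule sums_le[OF _ shift d]) (use assms in \<open>intro mult_right_mono power_Suc_diff_bounds, simp\<close>)
  show "(1 - q) * power_sum (Suc (Suc j)) q \<le> real (Suc (Suc j)) * power_sum (Suc j) q"
  proof (rule sums_le[OF _ d sums_mult[OF shift]])
    fix n
    have "(real (Suc n) ^ Suc (Suc j) - real n ^ Suc (Suc j)) * q ^ Suc n \<le> (real (Suc (Suc j)) * real (Suc n) ^ Suc j) * q ^ Suc n"
      using assms by (intro mult_right_mono power_Suc_diff_bounds) simp
    then show "(real (Suc n) ^ Suc (Suc j) - real n ^ Suc (Suc j)) * q ^ Suc n \<le> real (Suc (Suc j)) * (real (Suc n) ^ Suc j * q ^ Suc n)"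
      by (simp only: mult.assoc)
  qed
qed

lemma power_sum_bounds:
  assumes "0 \<le> q" "q < 1"
  shows "q / (1 - q) ^ (j + 2) \<le> power_sum (Suc j) q \<and>
    power_sum (Suc j) q \<le> fact (Suc j) * q / (1 - q) ^ (j + 2)"
proof (induction j)
  case 0
  have "power_sum (Suc 0) q = q / (1 - q)\<^sup>2"
    using sums_nat_times_power[of q] assms by (simp add: power_sum_def sums_iff)
  then show ?case by (simp add: power2_eq_square)
next
  case (Suc j)
  have e: "1 - q > 0" using assms by simp
  have eq: "x / (1 - q) ^ (Suc j + 2) = x / (1 - q) ^ (j + 2) / (1 - q)" for x
    by simp
  have "q / (1 - q) ^ (j + 2) \<le> power_sum (Suc (Suc j)) q * (1 - q)"
    using Suc power_sum_step(1)[OF assms, of j] by (simp add: mult.commute)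
  then have "q / (1 - q) ^ (Suc j + 2) \<le> power_sum (Suc (Suc j)) q"
    unfolding eq using e by (simp only: pos_divide_le_eq)
  moreover have "power_sum (Suc (Suc j)) q * (1 - q) \<le> real (Suc (Suc j)) * (fact (Suc j) * q / (1 - q) ^ (j + 2))"
    using power_sum_step(2)[OF assms, of j] mult_left_mono[OF conjunct2[OF Suc], of "real (Suc (Suc j))"]
    by (simp only: mult.commute[of "power_sum _ _"]) linarith
  then have "power_sum (Suc (Suc j)) q \<le> fact (Suc (Suc j)) * q / (1 - q) ^ (Suc j + 2)"
    unfolding eq using e by (simp only: pos_le_divide_eq fact_Suc[of "Suc j"] of_nat_mult mult.assoc times_divide_eq_right)
  ultimately show ?case by blast
qed

lemma moment_bounds:
  assumes "0 \<le> q" "q < 1"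
  shows "power_sum (Suc k) q \<le> moment k q" "moment k q \<le> 2 * power_sum (Suc k) q"
proof -
  have s: "(\<lambda>n. real n ^ Suc k * q ^ n) sums power_sum (Suc k) q"
    unfolding power_sum_def by (intro summable_sums summable_power_times_geometric assms)
  have m: "(\<lambda>n. sigma_weight n * real n ^ k * q ^ n) sums moment k q"
    unfolding moment_def by (intro summable_sums summable_sigma_weight_moment assms)
  have "real n ^ Suc k * q ^ n \<le> sigma_weight n * real n ^ k * q ^ n" for n
    using assms sigma_weight_ge[of n] by (simp add: mult_right_mono)
  then show "power_sum (Suc k) q \<le> moment k q" by (rule sums_le[OF _ s m])
  have "sigma_weight n * real n ^ k * q ^ n \<le> 2 * (real n ^ Suc k * q ^ n)" for n
  proof -
    have "sigma_weight n * (real n ^ k * q ^ n) \<le> 2 * real n * (real n ^ k * q ^ n)"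
      using assms by (intro mult_right_mono sigma_weight_le) auto
    then show ?thesis by (simp add: mult_ac)
  qed
  then show "moment k q \<le> 2 * power_sum (Suc k) q" by (rule sums_le[OF _ m sums_mult[OF s]])
qed

text \<open>
  With \<open>e = 1 - q\<close>, the mean is at least of order \<open>e ^ (- 3)\<close>, the variance exactly of order
  \<open>e ^ (- 4)\<close> and the third cumulant at most of order \<open>e ^ (- 5)\<close>. At the scale \<open>t = u / \<sigma>\<close>, of order \<open>e\<^sup>2\<close>, the cubic term is therefore of order \<open>e\<close>,
  which is what the central limit theorem requires.
\<close>

lemma moment_estimates:
  assumes "1 / 2 \<le> q" "q < 1"
  shows "1 / (2 * (1 - q) ^ 3) \<le> moment 1 q"
    and "1 / (2 * (1 - q) ^ 4) \<le> moment 2 q" "moment 2 q \<le> 12 / (1 - q) ^ 4"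
    and "moment 3 q \<le> 48 / (1 - q) ^ 5"
proof -
  have q: "0 \<le> q" "q < 1" using assms by auto
  have lower: "1 / (2 * (1 - q) ^ (k + 2)) \<le> moment k q" for k
  proof -
    have "1 / (2 * (1 - q) ^ (k + 2)) = (1 / 2) / (1 - q) ^ (k + 2)" by simp
    also have "\<dots> \<le> q / (1 - q) ^ (k + 2)"
      using assms by (intro divide_right_mono) auto
    also have "\<dots> \<le> power_sum (Suc k) q" using power_sum_bounds[OF q, of k] by simp
    also have "\<dots> \<le> moment k q" by (rule moment_bounds[OF q])
    finally show ?thesis .
  qed
  have upper: "moment k q \<le> (2 * fact (Suc k)) / (1 - q) ^ (k + 2)" for k
  proof -
    have "moment k q \<le> 2 * power_sum (Suc k) q" by (rule moment_bounds[OF q])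
    also have "\<dots> \<le> 2 * (fact (Suc k) * q / (1 - q) ^ (k + 2))"
      using power_sum_bounds[OF q, of k] by simp
    also have "\<dots> = (2 * fact (Suc k) * q) / (1 - q) ^ (k + 2)" by simp
    also have "\<dots> \<le> (2 * fact (Suc k)) / (1 - q) ^ (k + 2)"
      using q by (intro divide_right_mono mult_left_le) auto
    finally show ?thesis .
  qed
  show "1 / (2 * (1 - q) ^ 3) \<le> moment 1 q" using lower[of 1] by (simp add: numeral_3_eq_3)
  show "1 / (2 * (1 - q) ^ 4) \<le> moment 2 q" using lower[of 2] by (simp add: eval_nat_numeral)
  show "moment 2 q \<le> 12 / (1 - q) ^ 4" using upper[of 2] by (simp add: eval_nat_numeral)
  show "moment 3 q \<le> 48 / (1 - q) ^ 5" using upper[of 3] by (simp add: eval_nat_numeral)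
qed

section \<open>The characteristic function\<close>

text \<open>
  The logarithm of the characteristic function of the compound Poisson variable, that is,
  \<open>\<Sum>N. w N * ((q * cis t) ^ N - q ^ N)\<close>.
\<close>

definition log_char :: "real \<Rightarrow> real \<Rightarrow> complex" where
  "log_char q t = (\<Sum>n. of_real (sigma_weight n * q ^ n) * (cis (real n * t) - 1))"

lemma sums_log_char:
  assumes "0 \<le> q" "q < 1"
  shows "(\<lambda>n. of_real (sigma_weight n * q ^ n) * (cis (real n * t) - 1)) sums log_char q t"
  unfolding log_char_def
proof (rule summable_sums[OF summable_comparison_test'])
  show "summable (\<lambda>n. 2 * (sigma_weight n * q ^ n))"
    by (intro summable_mult summable_sigma_weight assms)
  fix n
  have "norm (cis (real n * t) - 1) \<le> 2"
    using norm_triangle_ineq4[of "cis (real n * t)" 1] by simp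
  then show "norm (of_real (sigma_weight n * q ^ n) * (cis (real n * t) - 1)) \<le> 2 * (sigma_weight n * q ^ n)"
  proof -
    assume le: "norm (cis (real n * t) - 1) \<le> 2"
    have c: "0 \<le> sigma_weight n * q ^ n" using assms sigma_weight_nonneg[of n] by simp
    show ?thesis
      unfolding norm_mult norm_of_real abs_of_nonneg[OF c]
      using mult_left_mono[OF le c] by (simp only: mult.commute)
  qed
qed

lemma cis_taylor:
  "norm (cis x - 1) \<le> \<bar>x\<bar>"
  "norm (cis x - 1 - \<i> * of_real x) \<le> x\<^sup>2 / 2"
  "norm (cis x - 1 - \<i> * of_real x + of_real (x\<^sup>2 / 2)) \<le> \<bar>x\<bar> ^ 3 / 6"
proof -
  have e: "exp (\<i> * of_real x) = cis x" by (simp add: cis_conv_exp)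
  show "norm (cis x - 1) \<le> \<bar>x\<bar>"
    using iexp_approx1[of x 0] by (simp add: e)
  show "norm (cis x - 1 - \<i> * of_real x) \<le> x\<^sup>2 / 2"
    using iexp_approx1[of x 1] by (simp add: e power2_eq_square algebra_simps)
  show "norm (cis x - 1 - \<i> * of_real x + of_real (x\<^sup>2 / 2)) \<le> \<bar>x\<bar> ^ 3 / 6"
    using iexp_approx1[of x 2]
    by (simp add: e eval_nat_numeral algebra_simps) 
qed

text \<open>
  The Taylor estimate for \<open>cis\<close> is global, so it can be applied to each term \<open>cis (N * t)\<close>, whatever
  the size of \<open>N * t\<close>, and then summed.
\<close>

lemma log_char_taylor:
  assumes "0 \<le> q" "q < 1"
  shows "norm (log_char q t - \<i> * of_real (moment 1 q * t) + of_real (moment 2 q * t\<^sup>2 / 2)) \<le> moment 3 q * \<bar>t\<bar> ^ 3 / 6"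
proof -
  let ?a = "\<lambda>n. complex_of_real (sigma_weight n * q ^ n)"
  have m: "(\<lambda>n. sigma_weight n * real n ^ k * q ^ n) sums moment k q" for k
    unfolding moment_def by (intro summable_sums summable_sigma_weight_moment assms)
  have m1: "(\<lambda>n. \<i> * of_real (sigma_weight n * real n ^ 1 * q ^ n * t)) sums (\<i> * of_real (moment 1 q * t))"
    by (intro sums_mult sums_of_real sums_mult2 m)
  have m2: "(\<lambda>n. of_real (sigma_weight n * real n ^ 2 * q ^ n * (t\<^sup>2 / 2))) sums (of_real (moment 2 q * (t\<^sup>2 / 2)) :: complex)"
    by (intro sums_of_real sums_mult2 m)
  let ?f = "\<lambda>n. ?a n * (cis (real n * t) - 1 - \<i> * of_real (real n * t) + of_real ((real n * t)\<^sup>2 / 2))"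
  have "(\<lambda>n. ?a n * (cis (real n * t) - 1) - \<i> * of_real (sigma_weight n * real n ^ 1 * q ^ n * t)
      + of_real (sigma_weight n * real n ^ 2 * q ^ n * (t\<^sup>2 / 2))) sums
      (log_char q t - \<i> * of_real (moment 1 q * t) + of_real (moment 2 q * (t\<^sup>2 / 2)))"
    by (intro sums_add sums_diff sums_log_char m1 m2 assms)
  also have "(\<lambda>n. ?a n * (cis (real n * t) - 1) - \<i> * of_real (sigma_weight n * real n ^ 1 * q ^ n * t)
      + of_real (sigma_weight n * real n ^ 2 * q ^ n * (t\<^sup>2 / 2))) = ?f"
    by (simp add: fun_eq_iff algebra_simps power_mult_distrib)
  finally have f: "?f sums (log_char q t - \<i> * of_real (moment 1 q * t) + of_real (moment 2 q * t\<^sup>2 / 2))"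
    by (simp only: times_divide_eq_right)
  have b: "(\<lambda>n. sigma_weight n * real n ^ 3 * q ^ n * (\<bar>t\<bar> ^ 3 / 6)) sums (moment 3 q * (\<bar>t\<bar> ^ 3 / 6))"
    by (intro sums_mult2 m)
  have le: "norm (?f n) \<le> sigma_weight n * real n ^ 3 * q ^ n * (\<bar>t\<bar> ^ 3 / 6)" for n
  proof -
    have "norm (?f n) = sigma_weight n * q ^ n * norm (cis (real n * t) - 1 - \<i> * of_real (real n * t) + of_real ((real n * t)\<^sup>2 / 2))"
      using assms sigma_weight_nonneg[of n] by (simp only: norm_mult norm_of_real abs_of_nonneg[OF mult_nonneg_nonneg] zero_le_power)
    also have "\<dots> \<le> sigma_weight n * q ^ n * (\<bar>real n * t\<bar> ^ 3 / 6)"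
      using assms sigma_weight_nonneg[of n] by (intro mult_left_mono cis_taylor(3)) simp
    finally show ?thesis by (simp add: abs_mult power_mult_distrib mult_ac)
  qed
  have "norm (suminf ?f) \<le> (\<Sum>n. sigma_weight n * real n ^ 3 * q ^ n * (\<bar>t\<bar> ^ 3 / 6))"
    by (rule norm_suminf_le[OF le sums_summable[OF b]])
  then show ?thesis
    using sums_unique[OF f] sums_unique[OF b] by simp
qed

text \<open>
  By \<open>1 - cos t = 2 * sin\<^sup>2 (t / 2)\<close> and \<open>sin y \<ge> y - y ^ 3 / 6 \<ge> y / 2\<close>; the second step needs \<open>y\<^sup>2 \<le> 3\<close>,
  which holds for \<open>y \<le> \<pi> / 2\<close>.
\<close>

lemma one_minus_cos_ge:
  assumes "\<bar>t\<bar> \<le> pi"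
  shows "t\<^sup>2 / 8 \<le> 1 - cos t"
proof -
  define y where "y = \<bar>t\<bar> / 2"
  have y: "0 \<le> y" "y \<le> 8 / 5" using assms pi_less_4 pi_approx by (auto simp: y_def)
  have "\<bar>sin y - (\<Sum>m<3. sin_coeff m * y ^ m)\<bar> \<le> inverse (fact 3) * \<bar>y\<bar> ^ 3"
    by (rule Maclaurin_sin_bound)
  also have "(\<Sum>m<3. sin_coeff m * y ^ m) = y"
    by (simp add: sin_coeff_def numeral_3_eq_3)
  finally have "\<bar>sin y - y\<bar> \<le> y ^ 3 / 6"
    using y by (simp add: fact_numeral)
  then have "y - y ^ 3 / 6 \<le> sin y" by linarith
  moreover have "y ^ 3 / 6 \<le> y / 2"
  proof -
    have "y\<^sup>2 \<le> (8 / 5)\<^sup>2" using y by (intro power_mono) auto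
    then have "y * y\<^sup>2 \<le> y * 3" using y by (intro mult_left_mono) (auto simp: power2_eq_square)
    then show ?thesis by (simp add: power3_eq_cube power2_eq_square)
  qed
  ultimately have "y / 2 \<le> sin y" by simp
  then have "(y / 2)\<^sup>2 \<le> (sin y)\<^sup>2" using y by (intro power_mono) auto
  moreover have "1 - cos t = 2 * (sin y)\<^sup>2"
    using cos_double_sin[of y] by (simp add: y_def)
  moreover have "t\<^sup>2 / 8 = 2 * (y / 2)\<^sup>2"
    by (simp add: y_def power_divide)
  ultimately show ?thesis by simp
qed

lemma norm_one_minus_polar: "(norm (1 - of_real q * cis t))\<^sup>2 = (1 - q)\<^sup>2 + 2 * q * (1 - cos t)"
proof -
  have "(norm (1 - of_real q * cis t))\<^sup>2 = (1 - q * cos t)\<^sup>2 + (q * sin t)\<^sup>2"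
    by (simp add: cmod_power2)
  also have "\<dots> = 1 - 2 * q * cos t + q\<^sup>2 * ((sin t)\<^sup>2 + (cos t)\<^sup>2)"
    by (simp add: power2_eq_square algebra_simps del: sin_cos_squared_add3 sin_cos_squared_add2 sin_cos_squared_add)
  also have "\<dots> = (1 - q)\<^sup>2 + 2 * q * (1 - cos t)"
    unfolding sin_cos_squared_add by (simp add: power2_eq_square algebra_simps)
  finally show ?thesis .
qed

text \<open>
  The real part is \<open>- (\<Sum>N. w N * q ^ N * (1 - cos (N * t)))\<close>. Since \<open>w N \<ge> N\<close>, it is at most the same
  expression with \<open>w N\<close> replaced by \<open>N\<close>, which has a closed form because
  \<open>\<Sum>N. N * z ^ N = z / (1 - z)\<^sup>2\<close>.
\<close>

lemma Re_log_char_le: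
  assumes "0 \<le> q" "q < 1"
  shows "Re (log_char q t) \<le> q / ((1 - q)\<^sup>2 + 2 * q * (1 - cos t)) - q / (1 - q)\<^sup>2"
proof -
  let ?z = "of_real q * cis t"
  have z: "norm ?z < 1" using assms by (simp add: norm_mult)
  have A: "(\<lambda>n. Re (of_real (sigma_weight n * q ^ n) * (cis (real n * t) - 1))) sums Re (log_char q t)"
    by (rule sums_Re[OF sums_log_char[OF assms]])
  have B: "(\<lambda>n. Re (of_nat n * ?z ^ n) - real n * q ^ n) sums (Re (?z / (1 - ?z)\<^sup>2) - q / (1 - q)\<^sup>2)"
    using sums_nat_times_power[of q] assms
    by (intro sums_diff sums_Re sums_nat_times_power[OF z]) simp
  have C: "Re (of_real (sigma_weight n * q ^ n) * (cis (real n * t) - 1)) \<le> Re (of_nat n * ?z ^ n) - real n * q ^ n" for n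
  proof -
    have le: "(q ^ n * (1 - cos (real n * t))) * real n \<le> (q ^ n * (1 - cos (real n * t))) * sigma_weight n"
      using assms by (intro mult_left_mono sigma_weight_ge mult_nonneg_nonneg) auto
    have zn: "?z ^ n = of_real (q ^ n) * cis (real n * t)"
      by (simp only: power_mult_distrib Complex.DeMoivre of_real_power)
    show ?thesis unfolding zn using le by (simp add: algebra_simps)
  qed
  have "Re (log_char q t) \<le> Re (?z / (1 - ?z)\<^sup>2) - q / (1 - q)\<^sup>2"
    by (rule sums_le[OF C A B])
  also have "Re (?z / (1 - ?z)\<^sup>2) \<le> norm (?z / (1 - ?z)\<^sup>2)"
    by (rule complex_Re_le_cmod)
  also have "\<dots> = q / ((1 - q)\<^sup>2 + 2 * q * (1 - cos t))"
    using assms by (simp add: norm_divide norm_mult norm_power norm_one_minus_polar)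
  finally show ?thesis by simp
qed

definition stddev :: "real \<Rightarrow> real" where
  "stddev q = sqrt (moment 2 q)"

lemma stddev_bounds:
  assumes "1 / 2 \<le> q" "q < 1"
  shows "1 / (2 * (1 - q)\<^sup>2) \<le> stddev q" "stddev q \<le> 4 / (1 - q)\<^sup>2" "0 < stddev q" "(stddev q)\<^sup>2 = moment 2 q"
proof -
  have e: "0 < 1 - q" using assms by simp
  have m: "1 / (2 * (1 - q) ^ 4) \<le> moment 2 q" "moment 2 q \<le> 12 / (1 - q) ^ 4"
    using moment_estimates[OF assms] by auto
  have "(1 / (2 * (1 - q)\<^sup>2))\<^sup>2 = 1 / (4 * (1 - q) ^ 4)"
    by (simp add: power_divide power_mult_distrib flip: power_mult)
  also have "\<dots> \<le> 1 / (2 * (1 - q) ^ 4)"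
    using e by (intro divide_left_mono) auto
  also note m(1)
  finally show "1 / (2 * (1 - q)\<^sup>2) \<le> stddev q"
    unfolding stddev_def by (rule real_le_rsqrt)
  have "moment 2 q \<le> 12 / (1 - q) ^ 4" by (rule m)
  also have "\<dots> \<le> 16 / (1 - q) ^ 4"
    using e by (intro divide_right_mono) auto
  also have "\<dots> = (4 / (1 - q)\<^sup>2)\<^sup>2"
    by (simp add: power_divide flip: power_mult)
  finally show "stddev q \<le> 4 / (1 - q)\<^sup>2"
    unfolding stddev_def using e by (intro real_le_lsqrt) auto
  have "0 < 1 / (2 * (1 - q) ^ 4)" using e by simp
  then have "0 < moment 2 q" using m(1) by linarith
  then show "0 < stddev q" "(stddev q)\<^sup>2 = moment 2 q" by (simp_all add: stddev_def)
qed

text \<open>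
  With \<open>e = 1 - q\<close>, the previous estimates give the exponent \<open>- u\<^sup>2 / (192 + 2 * u\<^sup>2 * e\<^sup>2)\<close>. On the range
  \<open>\<bar>u\<bar> \<le> \<pi> * \<sigma>\<close>, where \<open>\<sigma> \<le> 4 / e\<^sup>2\<close>, one has \<open>u\<^sup>2 * e\<^sup>2 \<le> 16 * \<bar>u\<bar>\<close>, so the exponent is at most linear in
  \<open>- \<bar>u\<bar>\<close>: this covers both the Gaussian regime near \<open>0\<close> and the minor arcs.
\<close>

lemma norm_exp_log_char_le:
  assumes q: "1 / 2 \<le> q" "q < 1" and u: "\<bar>u\<bar> \<le> pi * stddev q"
  shows "norm (exp (log_char q (u / stddev q))) \<le> exp (6 / 32) * exp (- \<bar>u\<bar> / 32)"
proof -
  define e where "e = 1 - q"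
  \<comment> \<open>A lower bound for \<open>1 - cos t\<close>, from \<open>t\<^sup>2 / 8\<close> and \<open>\<sigma>\<^sup>2 \<le> 12 / e ^ 4\<close>.\<close>
  define s where "s = u\<^sup>2 * e ^ 4 / 96"
  let ?t = "u / stddev q"
  have e: "0 < e" "e \<le> 1 / 2" using q by (auto simp: e_def)
  have sd: "0 < stddev q" "stddev q \<le> 4 / e\<^sup>2" "(stddev q)\<^sup>2 \<le> 12 / e ^ 4"
    using stddev_bounds[OF q] moment_estimates[OF q] by (auto simp: e_def)
  have s0: "0 \<le> s" by (simp add: s_def)
  have t: "\<bar>?t\<bar> \<le> pi" using u sd(1) by (simp add: field_simps)
  have "s \<le> ?t\<^sup>2 / 8"
  proof -
    have "u\<^sup>2 / (12 / e ^ 4) \<le> u\<^sup>2 / (stddev q)\<^sup>2"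
      using sd e by (intro divide_left_mono) auto
    then show ?thesis by (simp add: s_def power_divide mult.commute)
  qed
  also have "\<dots> \<le> 1 - cos ?t" by (rule one_minus_cos_ge[OF t])
  also have "\<dots> \<le> 2 * q * (1 - cos ?t)"
    using q mult_right_mono[of 1 "2 * q" "1 - cos ?t"] by simp
  finally have "q / (e\<^sup>2 + 2 * q * (1 - cos ?t)) \<le> q / (e\<^sup>2 + s)"
    using q e s0 by (intro divide_left_mono) (auto intro!: mult_pos_pos add_pos_nonneg)
  then have "Re (log_char q ?t) \<le> q / (e\<^sup>2 + s) - q / e\<^sup>2"
    using Re_log_char_le[of q ?t] q by (simp add: e_def)
  also have "\<dots> = - (q * (s / (e\<^sup>2 * (e\<^sup>2 + s))))"
  proof -
    have "q / (X + s) - q / X = - (q * (s / (X * (X + s))))" if "X > 0" for X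
    proof -
      have "q / (X + s) - q / X = (q * X - q * (X + s)) / ((X + s) * X)"
        using that s0 by (intro diff_frac_eq) auto
      also have "q * X - q * (X + s) = - (q * s)" by (simp add: distrib_left)
      finally show ?thesis by (simp add: mult.commute)
    qed
    then show ?thesis using e by simp
  qed
  also have "\<dots> \<le> - (1 / 2 * (s / (e\<^sup>2 * (e\<^sup>2 + s))))"
    using q e s0 by (intro le_imp_neg_le mult_right_mono) auto
  also have "1 / 2 * (s / (e\<^sup>2 * (e\<^sup>2 + s))) = u\<^sup>2 / (192 + 2 * (u\<^sup>2 * e\<^sup>2))"
  proof -
    have "e\<^sup>2 * (e\<^sup>2 + s) = e ^ 4 * (1 + u\<^sup>2 * e\<^sup>2 / 96)"
      by (simp add: s_def power4_eq_xxxx power2_eq_square algebra_simps)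
    then have "s / (e\<^sup>2 * (e\<^sup>2 + s)) = (u\<^sup>2 / 96) / (1 + u\<^sup>2 * e\<^sup>2 / 96)"
      using e by (simp add: s_def)
    also have "\<dots> = u\<^sup>2 / (96 + u\<^sup>2 * e\<^sup>2)"
      by (simp add: field_simps)
    finally have *: "s / (e\<^sup>2 * (e\<^sup>2 + s)) = u\<^sup>2 / (96 + u\<^sup>2 * e\<^sup>2)" .
    show ?thesis unfolding * by (simp add: field_simps)
  qed
  also have "- (u\<^sup>2 / (192 + 2 * (u\<^sup>2 * e\<^sup>2))) \<le> - (u\<^sup>2 / (192 + 32 * \<bar>u\<bar>))"
  proof -
    have "\<bar>u\<bar> * e\<^sup>2 \<le> pi * stddev q * e\<^sup>2" using u by (intro mult_right_mono) auto
    also have "\<dots> \<le> 4 * (4 / e\<^sup>2) * e\<^sup>2"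
      using sd pi_less_4 by (intro mult_right_mono mult_mono) auto
    also have "\<dots> = 16" using e by simp
    finally have "\<bar>u\<bar> * (\<bar>u\<bar> * e\<^sup>2) \<le> \<bar>u\<bar> * 16" by (rule mult_left_mono) simp
    then have "u\<^sup>2 * e\<^sup>2 \<le> 16 * \<bar>u\<bar>" by (simp add: power2_eq_square flip: mult.assoc)
    then have "u\<^sup>2 / (192 + 32 * \<bar>u\<bar>) \<le> u\<^sup>2 / (192 + 2 * (u\<^sup>2 * e\<^sup>2))"
      by (intro divide_left_mono mult_pos_pos add_pos_nonneg add_left_mono) (simp_all add: mult.commute)
    then show ?thesis by simp
  qed
  also have "- (u\<^sup>2 / (192 + 32 * \<bar>u\<bar>)) \<le> 6 / 32 - \<bar>u\<bar> / 32"
  proof -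
    have "(a - 6) * (192 + 32 * a) = 32 * (a\<^sup>2 - 36)" for a :: real
      by (simp add: algebra_simps power2_eq_square)
    from this[of "\<bar>u\<bar>"] have "(\<bar>u\<bar> - 6) * (192 + 32 * \<bar>u\<bar>) = 32 * (u\<^sup>2 - 36)"
      by simp
    then have "(\<bar>u\<bar> - 6) / 32 * (192 + 32 * \<bar>u\<bar>) \<le> u\<^sup>2" by simp
    then have "(\<bar>u\<bar> - 6) / 32 \<le> u\<^sup>2 / (192 + 32 * \<bar>u\<bar>)"
      by (simp only: pos_le_divide_eq[of "192 + 32 * \<bar>u\<bar>"] add_pos_nonneg abs_ge_zero)
    then show ?thesis by simp
  qed
  finally have "Re (log_char q ?t) \<le> 6 / 32 + - \<bar>u\<bar> / 32" by simp
  then show ?thesis by (simp flip: exp_add)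
qed

section \<open>Jensen polynomials as Fourier integrals\<close>

text \<open>
  MacMahon's formula on the circle of radius \<open>q\<close>.
\<close>

lemma char_expansion:
  assumes "0 \<le> q" "q < 1"
  shows "(\<lambda>n. of_real (real (PL n) * q ^ n) * cis (real n * t)) sums
    (of_real (exp (moment 0 q)) * exp (log_char q t))"
proof -
  let ?z = "of_real q * cis t"
  have z: "norm ?z < 1" using assms by (simp add: norm_mult)
  have zn: "?z ^ n = of_real (q ^ n) * cis (real n * t)" for n
    by (simp only: power_mult_distrib Complex.DeMoivre of_real_power)
  have "(\<lambda>n. of_real (sigma_weight n * real n ^ 0 * q ^ n)) sums complex_of_real (moment 0 q)"
    unfolding moment_def by (intro sums_of_real summable_sums summable_sigma_weight_moment assms)
  from sums_add[OF sums_log_char[OF assms, of t] this]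
  have "(\<lambda>n. of_real (sigma_weight n) * ?z ^ n) sums (log_char q t + of_real (moment 0 q))"
    unfolding zn by (simp add: algebra_simps)
  then have "(\<Sum>n. of_real (sigma_weight n) * ?z ^ n) = log_char q t + of_real (moment 0 q)"
    by (rule sums_unique[symmetric])
  then have "(\<lambda>n. of_nat (PL n) * ?z ^ n) sums exp (log_char q t + of_real (moment 0 q))"
    using MacMahon_complex[OF z] by (simp only:)
  then show ?thesis
    unfolding zn by (simp add: exp_add exp_of_real mult_ac)
qed

lemma measurable_cis_mult [measurable]: "(\<lambda>t. cis (c * t)) \<in> borel_measurable borel"
  by (intro borel_measurable_continuous_onI continuous_intros)

lemma measurable_log_char [measurable]: "log_char q \<in> borel_measurable borel"
  unfolding log_char_def by measurable

lemma integral_cis_period: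
  "(LINT t|lborel. indicator {-pi..pi} t *\<^sub>R cis ((real n - real l) * t)) = (if n = l then of_real (2 * pi) else 0)"
proof (cases "n = l")
  case True
  then show ?thesis by (simp add: scaleR_conv_of_real)
next
  case False
  define k where "k = real n - real l"
  have k: "k \<noteq> 0" using False by (simp add: k_def)
  have s: "sin (k * pi) = 0" by (simp add: k_def left_diff_distrib sin_diff)
  have "((\<lambda>t. cis (k * t) / (\<i> * of_real k)) has_vector_derivative cis (k * t)) (at t within S)" for t S
  proof -
    have "((\<lambda>w. exp (\<i> * of_real k * w) / (\<i> * of_real k)) has_field_derivative exp (\<i> * of_real k * of_real t)) (at (of_real t))"
      using k by (auto intro!: derivative_eq_intros)
    from has_vector_derivative_real_field[OF this]
    show ?thesis by (simp add: cis_conv_exp mult_ac)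
  qed
  then have "(LINT t|lborel. indicator {-pi..pi} t *\<^sub>R cis (k * t)) =
      cis (k * pi) / (\<i> * of_real k) - cis (k * (- pi)) / (\<i> * of_real k)"
    by (intro integral_FTC_Icc) (auto intro!: continuous_intros)
  also have "cis (k * (- pi)) = cis (k * pi)" using s by (simp add: complex_eq_iff)
  finally show ?thesis using False by (simp add: k_def)
qed

lemma integral_indicator_period: "(LINT t|lborel. indicator {-pi..pi} t) = 2 * pi"
  by simp

text \<open>
  Termwise integration of the expansion against \<open>cis (- l * t)\<close>, which is justified by absolute
  convergence.
\<close>

lemma fourier_coefficient:
  assumes "0 \<le> q" "q < 1"
  shows "(LINT t|lborel. indicator {-pi..pi} t *\<^sub>R (exp (log_char q t) * cis (- (real l * t)))) =
    of_real (2 * pi * (real (PL l) * q ^ l) / exp (moment 0 q))"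
proof -
  let ?p = "\<lambda>n. real (PL n) * q ^ n" and ?F = "exp (moment 0 q)"
  let ?f = "\<lambda>n t. of_real (?p n) * (indicator {-pi..pi} t *\<^sub>R cis ((real n - real l) * t))"
  have p0: "0 \<le> ?p n" for n using assms by simp
  have summ: "summable ?p" using MacMahon_real[OF assms] by (rule sums_summable)
  have nrm: "norm (?f n t) = ?p n * indicator {-pi..pi} t" for n t
    by (simp only: norm_mult norm_of_real abs_of_nonneg[OF p0]) simp
  have int: "integrable lborel (?f n)" for n
  proof (rule Bochner_Integration.integrable_bound)
    show "integrable lborel (\<lambda>t. ?p n * indicator {-pi..pi} t)" by simp
    show "AE t in lborel. norm (?f n t) \<le> norm (?p n * indicator {-pi..pi} t)"
      unfolding nrm by simp
  qed measurable
  have sums_f: "(\<lambda>n. ?f n t) sums (of_real ?F * (indicator {-pi..pi} t *\<^sub>R (exp (log_char q t) * cis (- (real l * t)))))" for t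
  proof -
    have "(\<lambda>n. (of_real (?p n) * cis (real n * t)) * (indicator {-pi..pi} t *\<^sub>R cis (- (real l * t)))) sums
       ((of_real ?F * exp (log_char q t)) * (indicator {-pi..pi} t *\<^sub>R cis (- (real l * t))))"
      by (rule sums_mult2[OF char_expansion[OF assms]])
    moreover have "(of_real (?p n) * cis (real n * t)) * (indicator {-pi..pi} t *\<^sub>R cis (- (real l * t))) = ?f n t" for n
    proof -
      have "cis (real n * t) * cis (- (real l * t)) = cis ((real n - real l) * t)"
        by (simp add: cis_mult left_diff_distrib)
      then show ?thesis by (simp only: mult_scaleR_right mult.assoc)
    qed
    moreover have "(of_real ?F * exp (log_char q t)) * (indicator {-pi..pi} t *\<^sub>R cis (- (real l * t))) =
        of_real ?F * (indicator {-pi..pi} t *\<^sub>R (exp (log_char q t) * cis (- (real l * t))))"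
      by (simp only: mult_scaleR_right mult.assoc)
    ultimately show ?thesis by (simp only:)
  qed
  have "(\<lambda>n. LINT t|lborel. ?f n t) sums (LINT t|lborel. (\<Sum>n. ?f n t))"
  proof (rule sums_integral[OF int])
    show "AE t in lborel. summable (\<lambda>n. norm (?f n t))"
      unfolding nrm by (intro AE_I2 summable_mult2 summ)
    have "(LINT t|lborel. norm (?f n t)) = ?p n * (2 * pi)" for n
      unfolding nrm by (simp only: integral_mult_right_zero integral_indicator_period)
    then show "summable (\<lambda>n. LINT t|lborel. norm (?f n t))"
      by (simp only: summable_mult2[OF summ])
  qed
  moreover have "(LINT t|lborel. ?f n t) = (if n = l then of_real (2 * pi * ?p l) else 0)" for n
    by (simp only: integral_mult_right_zero integral_cis_period) simp
  moreover have "(\<lambda>n. if n = l then complex_of_real (2 * pi * ?p l) else 0) sums of_real (2 * pi * ?p l)"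
    by (rule sums_single)
  ultimately have "(LINT t|lborel. (\<Sum>n. ?f n t)) = of_real (2 * pi * ?p l)"
    by (simp only:) (rule sums_unique2)
  moreover have "(\<Sum>n. ?f n t) = of_real ?F * (indicator {-pi..pi} t *\<^sub>R (exp (log_char q t) * cis (- (real l * t))))" for t
    using sums_unique[OF sums_f[of t]] by simp
  ultimately have F: "of_real ?F * (LINT t|lborel. indicator {-pi..pi} t *\<^sub>R (exp (log_char q t) * cis (- (real l * t)))) = of_real (2 * pi * ?p l)"
    by (simp only: integral_mult_right_zero)
  have "complex_of_real ?F \<noteq> 0" by simp
  then show ?thesis
    unfolding of_real_divide F[symmetric] by (rule nonzero_mult_div_cancel_left[symmetric])
qed

lemma norm_exp_log_char_le_1:
  assumes "0 \<le> q" "q < 1"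
  shows "norm (exp (log_char q t)) \<le> 1"
proof -
  have e: "0 < (1 - q)\<^sup>2" using assms by simp
  have "0 \<le> 2 * q * (1 - cos t)" using assms by simp
  then have "q / ((1 - q)\<^sup>2 + 2 * q * (1 - cos t)) \<le> q / (1 - q)\<^sup>2"
    using assms e by (intro divide_left_mono mult_pos_pos add_pos_nonneg) auto
  then show ?thesis using Re_log_char_le[OF assms, of t] by simp
qed

lemma integrable_fourier:
  assumes "0 \<le> q" "q < 1"
  shows "integrable lborel (\<lambda>t. indicator {-pi..pi} t *\<^sub>R (exp (log_char q t) * cis (- (c * t))))"
proof (rule Bochner_Integration.integrable_bound)
  show "integrable lborel (indicator {-pi..pi} :: real \<Rightarrow> real)" by simp
  show "AE t in lborel. norm (indicator {-pi..pi} t *\<^sub>R (exp (log_char q t) * cis (- (c * t)))) \<le> norm (indicator {-pi..pi} t :: real)"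
    using norm_exp_log_char_le_1[OF assms] by (intro AE_I2) (simp add: norm_mult split: split_indicator)
  have "(\<lambda>t. cis (- c * t)) \<in> borel_measurable borel" by (rule measurable_cis_mult)
  then have [measurable]: "(\<lambda>t. cis (- (c * t))) \<in> borel_measurable borel" by simp
  show "(\<lambda>t. indicator {-pi..pi} t *\<^sub>R (exp (log_char q t) * cis (- (c * t)))) \<in> borel_measurable lborel"
    by measurable
qed

lemma poly_jensen: "poly (jensen_poly a d n) x = (\<Sum>j\<le>d. real (d choose j) * a (n + j) * x ^ j)"
  by (simp add: jensen_poly_def poly_sum poly_monom atMost_atLeast0)

text \<open>
  The binomial theorem collects the Fourier integrals of the coefficients \<open>PL n, \<dots>, PL (n + d)\<close>, so the
  shift and the degree are handled exactly, without any comparison of neighbouring coefficients.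
\<close>

lemma jensen_as_integral:
  assumes "0 \<le> q" "q < 1"
  shows "(LINT t|lborel. indicator {-pi..pi} t *\<^sub>R
       ((1 + of_real w * cis (- t)) ^ d * (exp (log_char q t) * cis (- (real n * t))))) =
    of_real (2 * pi * q ^ n / exp (moment 0 q) * poly (jensen_poly (\<lambda>k. real (PL k)) d n) (q * w))"
proof -
  let ?h = "\<lambda>l t. indicator {-pi..pi} t *\<^sub>R (exp (log_char q t) * cis (- (real l * t)))"
  let ?c = "\<lambda>j. complex_of_real (real (d choose j) * w ^ j)"
  have "indicator {-pi..pi} t *\<^sub>R ((1 + of_real w * cis (- t)) ^ d * (exp (log_char q t) * cis (- (real n * t))))
     = (\<Sum>j\<le>d. ?c j * ?h (n + j) t)" for t
  proof -
    have "(1 + of_real w * cis (- t)) ^ d = (\<Sum>j\<le>d. ?c j * cis (- (real j * t)))"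
      using binomial_ring[of "of_real w * cis (- t)" 1 d]
      by (simp add: add.commute power_mult_distrib Complex.DeMoivre mult.assoc)
    moreover have "cis (- (real j * t)) * cis (- (real n * t)) = cis (- (real (n + j) * t))" for j
      by (simp add: cis_mult algebra_simps)
    ultimately show ?thesis
      by (simp add: sum_distrib_right scaleR_conv_of_real sum_distrib_left mult_ac)
  qed
  then have "(LINT t|lborel. indicator {-pi..pi} t *\<^sub>R
       ((1 + of_real w * cis (- t)) ^ d * (exp (log_char q t) * cis (- (real n * t))))) =
      (LINT t|lborel. (\<Sum>j\<le>d. ?c j * ?h (n + j) t))" by (simp only:)
  also have "\<dots> = (\<Sum>j\<le>d. ?c j * (LINT t|lborel. ?h (n + j) t))"
  proof -
    have int: "integrable lborel (\<lambda>t. ?c j * ?h (n + j) t)" for j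
      by (intro integrable_mult_right integrable_fourier assms)
    show ?thesis
      by (subst Bochner_Integration.integral_sum[OF int]) (simp only: integral_mult_right_zero)
  qed
  also have "\<dots> = (\<Sum>j\<le>d. ?c j * of_real (2 * pi * (real (PL (n + j)) * q ^ (n + j)) / exp (moment 0 q)))"
    by (simp only: fourier_coefficient[OF assms])
  also have "\<dots> = of_real (\<Sum>j\<le>d. real (d choose j) * w ^ j * (2 * pi * (real (PL (n + j)) * q ^ (n + j)) / exp (moment 0 q)))"
    by simp
  also have "(\<Sum>j\<le>d. real (d choose j) * w ^ j * (2 * pi * (real (PL (n + j)) * q ^ (n + j)) / exp (moment 0 q))) =
      2 * pi * q ^ n / exp (moment 0 q) * poly (jensen_poly (\<lambda>k. real (PL k)) d n) (q * w)"
    unfolding poly_jensen sum_distrib_left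
    by (intro sum.cong refl) (simp only: power_add power_mult_distrib times_divide_eq_right times_divide_eq_left mult_ac)
  finally show ?thesis .
qed

definition scaled_integrand :: "nat \<Rightarrow> real \<Rightarrow> real \<Rightarrow> real \<Rightarrow> complex" where
  "scaled_integrand d y q u = indicator {-(pi * stddev q)..pi * stddev q} u *\<^sub>R
     ((of_real (stddev q) * (1 - cis (- (u / stddev q))) + of_real y * cis (- (u / stddev q))) ^ d *
      (exp (log_char q (u / stddev q)) * cis (- (moment 1 q * (u / stddev q)))))"

text \<open>
  The substitution \<open>t = u / \<sigma>\<close> at the saddle point. The choice of the argument is made such that
  \<open>\<sigma> * (1 + w * cis (- t))\<close> stays bounded for bounded \<open>u\<close>: for \<open>w = - 1\<close> it vanishes at \<open>t = 0\<close>, and \<open>w = - 1 + y / \<sigma>\<close>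
  resolves the zero at the right scale.
\<close>

lemma jensen_as_scaled_integral:
  assumes q: "1 / 2 \<le> q" "q < 1" and n: "moment 1 q = real n"
  shows "(LINT u|lborel. scaled_integrand d y q u) =
    of_real (stddev q ^ Suc d * (2 * pi * q ^ n / exp (moment 0 q)) *
      poly (jensen_poly (\<lambda>k. real (PL k)) d n) (q * (- 1 + y / stddev q)))"
proof -
  let ?s = "stddev q" and ?w = "- 1 + y / stddev q"
  let ?g = "\<lambda>t. indicator {-pi..pi} t *\<^sub>R
       ((1 + of_real ?w * cis (- t)) ^ d * (exp (log_char q t) * cis (- (real n * t))))"
  have s: "0 < ?s" by (rule stddev_bounds[OF q])
  have q0: "0 \<le> q" using q by simp
  have eq: "scaled_integrand d y q u = of_real (?s ^ d) * ?g (0 + 1 / ?s * u)" for u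
  proof -
    have "indicator {-(pi * ?s)..pi * ?s} u = (indicator {-pi..pi} (u / ?s) :: real)"
      using s by (auto split: split_indicator simp: field_simps)
    moreover have "of_real ?s * (1 + of_real ?w * cis (- (u / ?s))) =
        of_real ?s * (1 - cis (- (u / ?s))) + of_real y * cis (- (u / ?s))"
      using s by (simp add: algebra_simps)
    then have "(of_real ?s * (1 - cis (- (u / ?s))) + of_real y * cis (- (u / ?s))) ^ d =
        of_real (?s ^ d) * (1 + of_real ?w * cis (- (u / ?s))) ^ d"
      by (simp only: power_mult_distrib[symmetric] of_real_power)
    ultimately show ?thesis
      unfolding scaled_integrand_def n by (simp add: scaleR_conv_of_real mult_ac)
  qed
  have "(LINT t|lborel. ?g t) = \<bar>1 / ?s\<bar> *\<^sub>R (LINT u|lborel. ?g (0 + 1 / ?s * u))"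
    by (rule lborel_integral_real_affine) (use s in simp)
  then have "(LINT u|lborel. ?g (0 + 1 / ?s * u)) = of_real ?s * (LINT t|lborel. ?g t)"
    using s by (simp add: scaleR_conv_of_real)
  then have "(LINT u|lborel. scaled_integrand d y q u) = of_real (?s ^ d) * (of_real ?s * (LINT t|lborel. ?g t))"
    unfolding eq by (simp only: integral_mult_right_zero)
  then show ?thesis
    unfolding jensen_as_integral[OF q0 q(2)] by (simp add: mult_ac)
qed

section \<open>The local limit\<close>

lemma norm_scaled_integrand_le:
  assumes q: "1 / 2 \<le> q" "q < 1"
  shows "norm (scaled_integrand d y q u) \<le> exp (6 / 32) * ((\<bar>u\<bar> + \<bar>y\<bar>) ^ d * exp (- \<bar>u\<bar> / 32))"
proof (cases "\<bar>u\<bar> \<le> pi * stddev q")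
  case True
  let ?s = "stddev q"
  have s: "0 < ?s" by (rule stddev_bounds[OF q])
  have "norm (of_real ?s * (1 - cis (- (u / ?s)))) = ?s * norm (cis (- (u / ?s)) - 1)"
    using s by (simp add: norm_mult norm_minus_commute)
  also have "\<dots> \<le> ?s * \<bar>- (u / ?s)\<bar>"
    using s by (intro mult_left_mono cis_taylor(1)) simp
  also have "\<dots> = \<bar>u\<bar>" using s by (simp add: abs_mult)
  finally have "norm (of_real ?s * (1 - cis (- (u / ?s)))) \<le> \<bar>u\<bar>" .
  then have "norm (of_real ?s * (1 - cis (- (u / ?s))) + of_real y * cis (- (u / ?s))) \<le> \<bar>u\<bar> + \<bar>y\<bar>"
    by (intro order_trans[OF norm_triangle_ineq] add_mono) (simp_all add: norm_mult)
  then have "norm (of_real ?s * (1 - cis (- (u / ?s))) + of_real y * cis (- (u / ?s))) ^ d \<le> (\<bar>u\<bar> + \<bar>y\<bar>) ^ d"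
    by (intro power_mono) auto
  moreover have "norm (exp (log_char q (u / ?s))) \<le> exp (6 / 32) * exp (- \<bar>u\<bar> / 32)"
    by (rule norm_exp_log_char_le[OF q True])
  moreover have "norm (scaled_integrand d y q u) =
      norm (of_real ?s * (1 - cis (- (u / ?s))) + of_real y * cis (- (u / ?s))) ^ d * norm (exp (log_char q (u / ?s)))"
    using True by (simp add: scaled_integrand_def norm_mult norm_power abs_le_iff)
  ultimately have "norm (scaled_integrand d y q u) \<le> (\<bar>u\<bar> + \<bar>y\<bar>) ^ d * (exp (6 / 32) * exp (- \<bar>u\<bar> / 32))"
    by (simp only: mult_mono norm_ge_zero zero_le_power abs_ge_zero add_nonneg_nonneg)
  then show ?thesis by (simp only: mult_ac)
next
  case False
  then have "u \<notin> {-(pi * stddev q)..pi * stddev q}"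
    by (metis abs_le_iff atLeastAtMost_iff minus_le_iff)
  then show ?thesis by (simp add: scaled_integrand_def)
qed

lemma scaled_integrand_tendsto:
  assumes q: "\<And>k. 1 / 2 \<le> q k" "\<And>k. q k < 1" and lim: "q \<longlonglongrightarrow> 1"
  shows "(\<lambda>k. scaled_integrand d y (q k) u) \<longlonglongrightarrow> gauss_integrand d y u"
proof -
  let ?s = "\<lambda>k. stddev (q k)"
  have e0: "(\<lambda>k. 1 - q k) \<longlonglongrightarrow> 0" using tendsto_diff[OF tendsto_const lim, of 1] by simp
  have e: "0 < 1 - q k" for k using q(2)[of k] by simp
  have s: "0 < ?s k" "1 / (2 * (1 - q k)\<^sup>2) \<le> ?s k" "(?s k)\<^sup>2 = moment 2 (q k)" for k
    using stddev_bounds[OF q] by auto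
  have inv: "1 / ?s k \<le> 2 * (1 - q k)\<^sup>2" for k
    using s(1,2)[of k] e[of k] by (simp add: field_simps)
  have inv0: "(\<lambda>k. 1 / ?s k) \<longlonglongrightarrow> 0"
  proof (rule tendsto_sandwich[where f = "\<lambda>_. 0" and h = "\<lambda>k. 2 * (1 - q k)\<^sup>2"])
    show "(\<lambda>k. 2 * (1 - q k)\<^sup>2) \<longlonglongrightarrow> 0"
      using tendsto_mult[OF tendsto_const tendsto_power[OF e0, of 2], of 2] by simp
    show "\<forall>\<^sub>F k in sequentially. 0 \<le> 1 / ?s k" using s(1) by (simp add: less_imp_le)
    show "\<forall>\<^sub>F k in sequentially. 1 / ?s k \<le> 2 * (1 - q k)\<^sup>2" using inv by simp
  qed simp
  have us0: "(\<lambda>k. - (u / ?s k)) \<longlonglongrightarrow> 0"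
    using tendsto_mult[OF tendsto_const inv0, of "- u"] by simp
  have c1: "(\<lambda>k. cis (- (u / ?s k))) \<longlonglongrightarrow> 1"
    using continuous_on_tendsto_compose[OF continuous_on_cis[OF continuous_on_id, of UNIV] us0] by simp
  have lin: "(\<lambda>k. of_real (?s k) * (1 - cis (- (u / ?s k)))) \<longlonglongrightarrow> \<i> * of_real u"
  proof (rule LIM_zero_cancel, rule Lim_null_comparison)
    show "(\<lambda>k. u\<^sup>2 / 2 * (1 / ?s k)) \<longlonglongrightarrow> 0"
      using tendsto_mult[OF tendsto_const inv0, of "u\<^sup>2 / 2"] by simp
    show "\<forall>\<^sub>F k in sequentially. norm (of_real (?s k) * (1 - cis (- (u / ?s k))) - \<i> * of_real u) \<le> u\<^sup>2 / 2 * (1 / ?s k)"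
    proof (rule always_eventually, rule allI)
      fix k
      let ?x = "- (u / ?s k)"
      have "of_real (?s k) * (1 - cis ?x) - \<i> * of_real u = - (of_real (?s k) * (cis ?x - 1 - \<i> * of_real ?x))"
        using s(1)[of k] by (simp add: algebra_simps)
      then have "norm (of_real (?s k) * (1 - cis ?x) - \<i> * of_real u) = ?s k * norm (cis ?x - 1 - \<i> * of_real ?x)"
        using s(1)[of k] by (simp only: norm_minus_cancel norm_mult norm_of_real abs_of_pos)
      also have "\<dots> \<le> ?s k * (?x\<^sup>2 / 2)"
        using s(1)[of k] by (intro mult_left_mono cis_taylor(2)) simp
      also have "\<dots> = u\<^sup>2 / 2 * (1 / ?s k)"
        using s(1)[of k] by (simp add: power_divide power2_eq_square)
      finally show "norm (of_real (?s k) * (1 - cis ?x) - \<i> * of_real u) \<le> u\<^sup>2 / 2 * (1 / ?s k)" .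
    qed
  qed
  have expo: "(\<lambda>k. log_char (q k) (u / ?s k) - \<i> * of_real (moment 1 (q k) * (u / ?s k))) \<longlonglongrightarrow> of_real (- u\<^sup>2 / 2)"
  proof (rule LIM_zero_cancel, rule Lim_null_comparison)
    show "(\<lambda>k. 64 * \<bar>u\<bar> ^ 3 * (1 - q k)) \<longlonglongrightarrow> 0"
      using tendsto_mult[OF tendsto_const e0, of "64 * \<bar>u\<bar> ^ 3"] by simp
    show "\<forall>\<^sub>F k in sequentially. norm (log_char (q k) (u / ?s k) - \<i> * of_real (moment 1 (q k) * (u / ?s k)) - of_real (- u\<^sup>2 / 2))
        \<le> 64 * \<bar>u\<bar> ^ 3 * (1 - q k)"
    proof (rule always_eventually, rule allI)
      fix k
      let ?t = "u / ?s k"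
      have q0: "0 \<le> q k" using q(1)[of k] by simp
      have "moment 2 (q k) * ?t\<^sup>2 = u\<^sup>2"
        using s(1)[of k] by (simp add: s(3)[symmetric] power_divide)
      then have "norm (log_char (q k) ?t - \<i> * of_real (moment 1 (q k) * ?t) - of_real (- u\<^sup>2 / 2)) \<le> moment 3 (q k) * \<bar>?t\<bar> ^ 3 / 6"
        using log_char_taylor[OF q0 q(2)[of k], of ?t] by simp
      also have "\<dots> \<le> (48 / (1 - q k) ^ 5) * (\<bar>u\<bar> * (2 * (1 - q k)\<^sup>2)) ^ 3 / 6"
      proof (intro divide_right_mono mult_mono power_mono)
        show "moment 3 (q k) \<le> 48 / (1 - q k) ^ 5" by (rule moment_estimates[OF q])
        have "\<bar>?t\<bar> = \<bar>u\<bar> * (1 / ?s k)" using s(1)[of k] by simp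
        then show "\<bar>?t\<bar> \<le> \<bar>u\<bar> * (2 * (1 - q k)\<^sup>2)" using inv[of k] by (simp only: mult_left_mono abs_ge_zero)
      qed (use e[of k] in auto)
      also have "\<dots> = 64 * \<bar>u\<bar> ^ 3 * (1 - q k)"
      proof -
        have "(48 / a ^ 5) * (v * (2 * a\<^sup>2)) ^ 3 / 6 = 64 * v ^ 3 * a" if "0 < a" for a v :: real
        proof -
          have "(v * (2 * a\<^sup>2)) ^ 3 = 8 * v ^ 3 * (a ^ 5 * a)"
            by (simp add: eval_nat_numeral)
          then show ?thesis using that by simp
        qed
        from this[OF e] show ?thesis .
      qed
      finally show "norm (log_char (q k) ?t - \<i> * of_real (moment 1 (q k) * ?t) - of_real (- u\<^sup>2 / 2)) \<le> 64 * \<bar>u\<bar> ^ 3 * (1 - q k)" .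
    qed
  qed
  have "exp (log_char (q k) t - \<i> * of_real c) = exp (log_char (q k) t) * cis (- c)" for k t c
    by (simp add: cis_conv_exp exp_diff exp_minus divide_inverse)
  then have ch: "(\<lambda>k. exp (log_char (q k) (u / ?s k)) * cis (- (moment 1 (q k) * (u / ?s k)))) \<longlonglongrightarrow> of_real (exp (- u\<^sup>2 / 2))"
    using tendsto_exp[OF expo] by (simp only: exp_of_real)
  let ?A = "\<lambda>k. (of_real (?s k) * (1 - cis (- (u / ?s k))) + of_real y * cis (- (u / ?s k))) ^ d *
      (exp (log_char (q k) (u / ?s k)) * cis (- (moment 1 (q k) * (u / ?s k))))"
  have "?A \<longlonglongrightarrow> (\<i> * of_real u + of_real y * 1) ^ d * of_real (exp (- u\<^sup>2 / 2))"
    by (intro tendsto_mult tendsto_power tendsto_add lin c1 ch tendsto_const)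
  then have A: "?A \<longlonglongrightarrow> gauss_integrand d y u"
    by (simp add: gauss_integrand_def add.commute)
  have "\<forall>\<^sub>F k in sequentially. \<bar>u\<bar> * (1 / ?s k) < pi"
    using tendsto_mult[OF tendsto_const inv0, of "\<bar>u\<bar>"] by (intro order_tendstoD(2)[where y = "\<bar>u\<bar> * 0"]) simp_all
  then have "\<forall>\<^sub>F k in sequentially. ?A k = scaled_integrand d y (q k) u"
  proof eventually_elim
    case (elim k)
    then have "\<bar>u\<bar> \<le> pi * ?s k" using s(1)[of k] by (simp add: field_simps)
    then show ?case by (simp add: scaled_integrand_def abs_le_iff)
  qed
  with A show ?thesis by (rule Lim_transform_eventually)
qed

lemma borel_measurable_scaled_integrand [measurable]: "scaled_integrand d y q \<in> borel_measurable borel"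
proof -
  have "(\<lambda>u. cis (c * u)) \<in> borel_measurable borel" for c by (rule measurable_cis_mult)
  from this[of "- (1 / stddev q)"] this[of "- (moment 1 q / stddev q)"]
  have [measurable]: "(\<lambda>u. cis (- (u / stddev q))) \<in> borel_measurable borel"
    "(\<lambda>u. cis (- (moment 1 q * (u / stddev q)))) \<in> borel_measurable borel" by simp_all
  show ?thesis unfolding scaled_integrand_def by measurable
qed

lemma scaled_integral_tendsto:
  assumes q: "\<And>k. 1 / 2 \<le> q k" "\<And>k. q k < 1" and lim: "q \<longlonglongrightarrow> 1"
  shows "(\<lambda>k. LINT u|lborel. scaled_integrand d y (q k) u) \<longlonglongrightarrow> gauss_moment d y"
  unfolding gauss_moment_def
proof (rule integral_dominated_convergence)
  show "integrable lborel (\<lambda>u. exp (6 / 32) * ((\<bar>u\<bar> + \<bar>y\<bar>) ^ d * exp (- \<bar>u\<bar> / 32)))"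
    by (intro integrable_mult_right integrable_power_times_exp) auto
  show "AE u in lborel. (\<lambda>k. scaled_integrand d y (q k) u) \<longlonglongrightarrow> gauss_integrand d y u"
    by (intro AE_I2 scaled_integrand_tendsto q lim)
  show "AE u in lborel. norm (scaled_integrand d y (q k) u) \<le> exp (6 / 32) * ((\<bar>u\<bar> + \<bar>y\<bar>) ^ d * exp (- \<bar>u\<bar> / 32))" for k
    by (intro AE_I2 norm_scaled_integrand_le q)
qed simp_all

section \<open>The saddle point and the theorem\<close>

text \<open>
  The mean is a continuous function of \<open>q\<close>; it vanishes at \<open>q = 0\<close> and exceeds \<open>n\<close> near \<open>q = 1\<close>.
\<close>

lemma saddle_point_exists: "\<exists>q. 0 \<le> q \<and> q < 1 \<and> moment 1 q = real n"
proof -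
  define b where "b = real n + 1"
  \<comment> \<open>At \<open>q = 1 - e\<close> the lower bound \<open>1 / (2 * e ^ 3)\<close> for the mean is \<open>4 * b ^ 3\<close>.\<close>
  define e where "e = 1 / (2 * b)"
  have e: "0 < e" "e \<le> 1 / 2" by (simp_all add: e_def b_def field_simps)
  have "real n \<le> 4 * b ^ 3"
    by (simp add: b_def power3_eq_cube algebra_simps)
  also have "\<dots> = 1 / (2 * e ^ 3)" by (simp add: e_def power_divide power_mult_distrib)
  also have "\<dots> \<le> moment 1 (1 - e)" using moment_estimates(1)[of "1 - e"] e by simp
  finally have up: "real n \<le> moment 1 (1 - e)" .
  have "isCont (moment 1) x" if "0 \<le> x" "x \<le> 1 - e" for x
    unfolding moment_def
  proof (rule isCont_powser)
    show "summable (\<lambda>n. sigma_weight n * real n ^ 1 * (1 - e / 2) ^ n)"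
      using e by (intro summable_sigma_weight_moment) auto
    show "norm x < norm (1 - e / 2)" using that e by simp
  qed
  then have cont: "continuous_on {0..1 - e} (moment 1)"
    by (intro continuous_at_imp_continuous_on) auto
  have "moment 1 0 = 0" unfolding moment_def by (subst powser_zero) simp
  then have "\<exists>q\<ge>0. q \<le> 1 - e \<and> moment 1 q = real n"
    using up e by (intro IVT' cont) auto
  then show ?thesis using e by force
qed

definition saddle :: "nat \<Rightarrow> real" where
  "saddle n = (SOME q. 0 \<le> q \<and> q < 1 \<and> moment 1 q = real n)"

lemma saddle: "0 \<le> saddle n" "saddle n < 1" "moment 1 (saddle n) = real n"
  using someI_ex[OF saddle_point_exists[of n]] by (simp_all add: saddle_def)

text \<open>
  The mean is at most \<open>4 / (1 - q) ^ 3\<close>, so a mean of \<open>n\<close> forces \<open>q\<close> close to \<open>1\<close>.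
\<close>

lemma saddle_tendsto: "saddle \<longlonglongrightarrow> 1"
proof (rule order_tendstoI)
  fix a :: real assume a: "a < 1"
  have "\<forall>\<^sub>F n in sequentially. 4 / (1 - a) ^ 3 < real n"
    by (rule eventually_compose_filterlim[OF eventually_gt_at_top filterlim_real_sequentially])
  then show "\<forall>\<^sub>F n in sequentially. a < saddle n"
  proof eventually_elim
    case (elim n)
    show ?case
    proof (rule ccontr)
      assume "\<not> a < saddle n"
      have "real n = moment 1 (saddle n)" by (simp only: saddle)
      also have "\<dots> \<le> 2 * power_sum (Suc 1) (saddle n)" by (intro moment_bounds saddle)
      also have "\<dots> \<le> 2 * (fact (Suc 1) * saddle n / (1 - saddle n) ^ (1 + 2))"
        using power_sum_bounds[OF saddle(1,2), of n 1] by simp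
      also have "\<dots> = 4 * saddle n / (1 - saddle n) ^ 3" by (simp add: numeral_3_eq_3)
      also have "\<dots> \<le> 4 / (1 - a) ^ 3"
        using saddle(1,2)[of n] a \<open>\<not> a < saddle n\<close> by (intro frac_le power_mono) auto
      finally show False using elim by simp
    qed
  qed
next
  fix a :: real assume "1 < a"
  then show "\<forall>\<^sub>F n in sequentially. saddle n < a"
    using saddle(2) by (intro always_eventually allI) (meson less_trans)
qed

lemma degree_jensen_le: "degree (jensen_poly a d n) \<le> d"
  unfolding jensen_poly_def
  by (intro degree_sum_le) (auto intro: order_trans[OF degree_monom_le])

text \<open>
  Up to a positive factor, the Jensen polynomial converges to the Hermite polynomial pointwise.
  Pointwise convergence suffices because finitely many signs decide the claim.
\<close>

lemma jensen_sign_eventually: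
  assumes "0 < c * poly (hermite d) y"
  shows "\<forall>\<^sub>F n in sequentially. 0 < c * poly (jensen_poly (\<lambda>k. real (PL k)) d n)
    (saddle n * (- 1 + y / stddev (saddle n)))"
proof -
  let ?J = "\<lambda>n. poly (jensen_poly (\<lambda>k. real (PL k)) d n) (saddle n * (- 1 + y / stddev (saddle n)))"
  let ?C = "\<lambda>n. stddev (saddle n) ^ Suc d * (2 * pi * saddle n ^ n / exp (moment 0 (saddle n)))"
  have "\<forall>\<^sub>F n in sequentially. 1 / 2 < saddle n"
    by (rule order_tendstoD(1)[OF saddle_tendsto]) simp
  then obtain N where N: "\<And>n. n \<ge> N \<Longrightarrow> 1 / 2 \<le> saddle n"
    unfolding eventually_sequentially by (meson less_imp_le)
  have "(\<lambda>k. LINT u|lborel. scaled_integrand d y (saddle (k + N)) u) \<longlonglongrightarrow> gauss_moment d y"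
    by (rule scaled_integral_tendsto) (use N saddle in \<open>auto intro: LIMSEQ_ignore_initial_segment saddle_tendsto\<close>)
  moreover have "(LINT u|lborel. scaled_integrand d y (saddle (k + N)) u) = of_real (?C (k + N) * ?J (k + N))" for k
    by (rule jensen_as_scaled_integral) (use N saddle in auto)
  ultimately have "(\<lambda>k. complex_of_real (?C (k + N) * ?J (k + N))) \<longlonglongrightarrow> of_real (sqrt (2 * pi) * poly (hermite d) y)"
    by (simp only: gauss_moment_eq_hermite)
  then have "(\<lambda>k. ?C (k + N) * ?J (k + N)) \<longlonglongrightarrow> sqrt (2 * pi) * poly (hermite d) y"
    by (simp only: tendsto_of_real_iff)
  then have "(\<lambda>k. c * (?C (k + N) * ?J (k + N))) \<longlonglongrightarrow> c * (sqrt (2 * pi) * poly (hermite d) y)"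
    by (rule tendsto_mult[OF tendsto_const])
  moreover have "0 < sqrt (2 * pi) * (c * poly (hermite d) y)"
    by (rule mult_pos_pos[OF _ assms]) simp
  then have "0 < c * (sqrt (2 * pi) * poly (hermite d) y)" by (simp only: mult.left_commute)
  ultimately have "\<forall>\<^sub>F k in sequentially. 0 < c * (?C (k + N) * ?J (k + N))"
    by (rule order_tendstoD(1))
  then have "\<forall>\<^sub>F k in sequentially. 0 < c * ?J (k + N)"
  proof eventually_elim
    case (elim k)
    have "0 < saddle (k + N)" using N[of "k + N"] by simp
    moreover have "0 < stddev (saddle (k + N))"
      by (rule stddev_bounds) (use N saddle in auto)
    ultimately have "0 < ?C (k + N)" by (intro mult_pos_pos zero_less_power divide_pos_pos) auto
    moreover have "0 < ?C (k + N) * (c * ?J (k + N))" using elim by (simp only: mult.left_commute)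
    ultimately show ?case by (rule zero_less_mult_pos[rotated])
  qed
  then show ?thesis by (rule eventually_sequentially_seg[THEN iffD1])
qed

theorem theorem1p2:
  fixes d :: nat
  assumes "d \<ge> 1"
  shows "\<exists>N::nat. \<forall>n::nat. n \<ge> N \<longrightarrow> hyperbolic (jensen_poly (\<lambda>k. real (PL k)) d n)"
proof -
  obtain y where y: "\<And>i. i < d \<Longrightarrow> y i < y (Suc i)"
    "\<And>i. i \<le> d \<Longrightarrow> 0 < (- 1) ^ (d - i) * poly (hermite d) (y i)"
    using hermite_alternates[of d] by blast
  let ?x = "\<lambda>n i. saddle n * (- 1 + y i / stddev (saddle n))"
  have "\<forall>\<^sub>F n in sequentially. \<forall>i\<in>{..d}. 0 < (- 1) ^ (d - i) * poly (jensen_poly (\<lambda>k. real (PL k)) d n) (?x n i)"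
    by (intro eventually_ball_finite ballI jensen_sign_eventually y(2)) auto
  moreover have "\<forall>\<^sub>F n in sequentially. 1 / 2 < saddle n"
    by (rule order_tendstoD(1)[OF saddle_tendsto]) simp
  ultimately have "\<forall>\<^sub>F n in sequentially. hyperbolic (jensen_poly (\<lambda>k. real (PL k)) d n)"
  proof eventually_elim
    case (elim n)
    have s: "0 < stddev (saddle n)" by (rule stddev_bounds) (use elim saddle in auto)
    show ?case
    proof (rule hyperbolic_if_alternates[OF degree_jensen_le])
      fix i assume "i < d"
      then have "y i / stddev (saddle n) < y (Suc i) / stddev (saddle n)"
        using y(1) s by (intro divide_strict_right_mono)
      then show "?x n i < ?x n (Suc i)"
        using elim by (intro mult_strict_left_mono) auto
    qed (use elim in auto)
  qed
  then show ?thesis by (simp add: eventually_sequentially)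
qed

end
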